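(* Let $n\ge 1$ and let $k_1,\dots,k_I$ be positive integers with $k_1+\cdots+k_I=n$. Let $\mathcal N(k_1,\dots,k_I)$ be the set of all normal complex $n\times n$ matrices which have exactly $I$ distinct eigenvalues, with multiplicities $k_1,\dots,k_I$ (the values of the eigenvalues being otherwise unrestricted). Then the real codimension of $\mathcal N(k_1,\dots,k_I)$ in the set of all normal complex $n\times n$ matrices is $$n+\sum_{i=1}^I k_i^2-2I \;=\; \sum_{i=1}^I (k_i-1)(k_i+2).$$
   Context: A complex $n\times n$ matrix $A$ is normal if $AA^\ast=A^\ast A$, where $A^\ast$ is the adjoint (conjugate transpose). "Real dimension" of a subset of the space of complex $n\times n$ matrices (viewed as a real vector space of dimension $2n^2$) is the usual dimension over $\mathbb R$ (of a real manifold, or of a semialgebraic set). The real codimension here is the real dimension of the set of all normal $n\times n$ matrices minus the real dimension of the subset. *)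

theory Defs
  imports "HOL-Analysis.Analysis" "HOL-Computational_Algebra.Polynomial"
begin

subsection \<open>Real dimension of a subset of a Euclidean space\<close>

definition C1_on :: "'a::euclidean_space set \<Rightarrow> ('a \<Rightarrow> 'a) \<Rightarrow> bool" where
  "C1_on U f \<longleftrightarrow>
     (\<exists>f' :: 'a \<Rightarrow> 'a \<Rightarrow>\<^sub>L 'a.
        (\<forall>x\<in>U. (f has_derivative blinfun_apply (f' x)) (at x)) \<and> continuous_on U f')"

text \<open>
  An embedded submanifold, in terms of slice charts: near each of its points a
  diffeomorphism between open sets of the ambient space straightens \<open>M\<close> to a
  \<open>d\<close>-dimensional linear subspace.  All dimensions are over the reals.
\<close>

definition submanifold :: "nat \<Rightarrow> 'a::euclidean_space set \<Rightarrow> bool" where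
  "submanifold d M \<longleftrightarrow>
     (\<forall>p\<in>M. \<exists>U V h g L.
        open U \<and> p \<in> U \<and> open V \<and> homeomorphism U V h g \<and> C1_on U h \<and> C1_on V g \<and>
        subspace L \<and> dim L = d \<and> h ` (M \<inter> U) = L \<inter> V)"

text \<open>
  The dimension of a set is the largest dimension of a nonempty submanifold contained
  in it, as in Lojasiewicz's geometry of semianalytic sets.  It agrees
  with the usual dimension both for submanifolds and for semialgebraic sets, where any
  degree of smoothness of the submanifolds gives the same number.  The maximum is over a
  finite set, since \<open>d\<close> is at most the dimension of the ambient space, and over a nonempty
  one if \<open>S \<noteq> {}\<close>, since single points are submanifolds of dimension 0.
\<close>

definition real_dim :: "'a::euclidean_space set \<Rightarrow> int" where
  "real_dim S =
     (if S = {} then - 1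
      else int (Max {d. \<exists>M. M \<noteq> {} \<and> M \<subseteq> S \<and> submanifold d M}))"

subsection \<open>Normal matrices and their eigenvalues\<close>

definition conj_transpose :: "complex^'n^'m \<Rightarrow> complex^'m^'n" where
  "conj_transpose A = (\<chi> i j. cnj (A $ j $ i))"

definition normal_matrix :: "complex^'n^'n \<Rightarrow> bool" where
  "normal_matrix A \<longleftrightarrow> A ** conj_transpose A = conj_transpose A ** A"

definition eigenvalues :: "complex^'n^'n \<Rightarrow> complex set" where
  "eigenvalues A = {c. \<exists>v. v \<noteq> 0 \<and> A *v v = c *s v}"

definition char_poly :: "complex^'n^'n \<Rightarrow> complex poly" where
  "char_poly A = det (\<chi> i j. (if i = j then [:0, 1:] else 0) - [:A $ i $ j:])"

definition multiplicity_of_eigenvalue :: "complex^'n^'n \<Rightarrow> complex \<Rightarrow> nat" where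
  "multiplicity_of_eigenvalue A c = order c (char_poly A)"

definition normal_matrices :: "(complex^'n^'n) set" where
  "normal_matrices = {A. normal_matrix A}"

text \<open>
  The bijection \<open>ev\<close> enumerates the eigenvalues without repetition, so there are exactly
  \<open>I\<close> of them; no order of the eigenvalues is prescribed.
\<close>

definition normal_matrices_with_mults :: "nat \<Rightarrow> (nat \<Rightarrow> nat) \<Rightarrow> (complex^'n^'n) set" where
  "normal_matrices_with_mults I k =
     {A. normal_matrix A \<and>
         (\<exists>ev. bij_betw ev {1..I} (eigenvalues A) \<and>
               (\<forall>i\<in>{1..I}. multiplicity_of_eigenvalue A (ev i) = k i))}"

definition real_codim_in_normal :: "(complex^'n^'n) set \<Rightarrow> int" where
  "real_codim_in_normal S = real_dim (normal_matrices :: (complex^'n^'n) set) - real_dim S"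

end

(* For a function d on the indices let W(d) be the space of matrices [K, diag d] + diag e with K
   skew-Hermitian and e constant where d is constant; it has dimension
   #{(i, j). d i ~= d j} + 2 #(range d). Moving the eigenvectors of diag d by unitary matrices and
   its eigenvalues within their coincidence pattern gives a submanifold with tangent space
   W(d), which yields the lower bounds.

   For the upper bounds let M be a submanifold consisting of normal matrices and choose a point A of M
   with the largest number of distinct eigenvalues; by the spectral theorem we may take A = diag d.
   Every tangent vector X of M at A lies in W(d). Its off-diagonal part is governed by the derivative of
   the normality equation. On an eigenspace of A it is a scalar: the eigenvalues of nearby points B of M
   converge bijectively to those of A, since by compactness a limit of the polynomials
   prod (x - mu) annihilating B annihilates A, so that no eigenvalue of A splits to first order. *)

theory Submission
  imports Defs "HOL-Computational_Algebra.Fundamental_Theorem_Algebra"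
begin

subsection \<open>Continuously differentiable maps\<close>

text \<open>\<open>real_dim\<close> is a maximum over all submanifolds inside a set, so an upper
  bound has to treat an arbitrary submanifold \<open>M\<close>. No smooth choice of eigenvalues or
  eigenvectors along \<open>M\<close> is constructed; the argument uses only difference quotients of
  sequences in \<open>M\<close>. The maximal number of eigenvalues at the chosen point is essential.
  At a scalar matrix, for example, normality gives no condition to first order, and every normal
  matrix is the velocity of a curve of normal matrices through that point, whereas
  \<open>W(d)\<close> has only dimension 2 there. Maximality keeps eigenvalues from splitting, and
  then the bound holds. The numbers arise as follows. With blocks of sizes k_i there are n^2 - sum
  k_i^2 ordered pairs of indices in different blocks, and each of the I eigenvalues contributes two
  real parameters. Simple spectrum gives n^2 - n + 2n = n^2 + n, the dimension of the whole set of
  normal matrices. The codimension is the difference n^2 + n - (n^2 - sum k_i^2 + 2I). One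
  upper-bound lemma serves both sets.\<close>

lemma C1_on_subset: "C1_on U f \<Longrightarrow> V \<subseteq> U \<Longrightarrow> C1_on V f"
  unfolding C1_on_def by (meson continuous_on_subset subsetD)

lemma C1_on_bounded_linear:
  fixes f :: "'a::euclidean_space \<Rightarrow> 'a"
  assumes "bounded_linear f"
  shows "C1_on U f"
  unfolding C1_on_def
  by (rule exI[of _ "\<lambda>_. Blinfun f"])
    (auto simp: bounded_linear_Blinfun_apply assms intro: bounded_linear_imp_has_derivative)

lemma C1_on_const: "C1_on U (\<lambda>x. c :: 'a::euclidean_space)"
  unfolding C1_on_def by (rule exI[of _ "\<lambda>_. 0"]) (auto simp: zero_blinfun.rep_eq)

lemma C1_on_add:
  assumes "C1_on U f" "C1_on U g"
  shows "C1_on U (\<lambda>x. f x + g x)"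
proof -
  from assms obtain f' g' where
    "\<And>x. x \<in> U \<Longrightarrow> (f has_derivative blinfun_apply (f' x)) (at x)" "continuous_on U f'"
    "\<And>x. x \<in> U \<Longrightarrow> (g has_derivative blinfun_apply (g' x)) (at x)" "continuous_on U g'"
    unfolding C1_on_def by blast
  then show ?thesis
    unfolding C1_on_def
    by (intro exI[of _ "\<lambda>x. f' x + g' x"])
      (auto simp: plus_blinfun.rep_eq intro!: continuous_intros has_derivative_add)
qed

lemma C1_on_compose:
  assumes "C1_on U f" "C1_on V g" "f ` U \<subseteq> V"
  shows "C1_on U (\<lambda>x. g (f x))"
proof -
  from assms obtain f' g' where
    f: "\<And>x. x \<in> U \<Longrightarrow> (f has_derivative blinfun_apply (f' x)) (at x)" "continuous_on U f'" and
    g: "\<And>x. x \<in> V \<Longrightarrow> (g has_derivative blinfun_apply (g' x)) (at x)" "continuous_on V g'"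
    unfolding C1_on_def by blast
  have "continuous_on U f"
    using f(1) has_derivative_continuous continuous_at_imp_continuous_on by blast
  then have "continuous_on U (\<lambda>x. g' (f x))"
    using continuous_on_compose2[OF g(2)] assms(3) by blast
  then have "continuous_on U (\<lambda>x. g' (f x) o\<^sub>L f' x)"
    using f(2) by (intro continuous_intros)
  moreover have "((\<lambda>x. g (f x)) has_derivative blinfun_apply (g' (f x) o\<^sub>L f' x)) (at x)"
    if "x \<in> U" for x
    using has_derivative_compose[OF f(1)[OF that] g(1)] assms(3) that
    by (auto simp: blinfun_compose.rep_eq o_def)
  ultimately show ?thesis
    unfolding C1_on_def by (intro exI[of _ "\<lambda>x. g' (f x) o\<^sub>L f' x"]) blast
qed

lemma C1_on_bilinear:
  fixes f g :: "'d::euclidean_space \<Rightarrow> 'd"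
  assumes "C1_on U f" "C1_on U g"
    and "bounded_bilinear (B :: 'd \<Rightarrow> 'd \<Rightarrow> 'd)"
  shows "C1_on U (\<lambda>x. B (f x) (g x))"
proof -
  interpret B: bounded_bilinear B by fact
  from assms obtain f' g' where
    f: "\<And>x. x \<in> U \<Longrightarrow> (f has_derivative blinfun_apply (f' x)) (at x)" "continuous_on U f'" and
    g: "\<And>x. x \<in> U \<Longrightarrow> (g has_derivative blinfun_apply (g' x)) (at x)" "continuous_on U g'"
    unfolding C1_on_def by blast
  have cont: "continuous_on U f" "continuous_on U g"
    by (meson f(1) g(1) has_derivative_continuous continuous_at_imp_continuous_on)+
  let ?D = "\<lambda>x. (B.prod_right (f x) o\<^sub>L g' x) + (B.prod_left (g x) o\<^sub>L f' x)"
  have "continuous_on U ?D"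
    using cont f(2) g(2)
    by (intro continuous_intros bounded_linear.continuous_on[OF B.bounded_linear_prod_left]
        bounded_linear.continuous_on[OF B.bounded_linear_prod_right])
  moreover have "((\<lambda>x. B (f x) (g x)) has_derivative blinfun_apply (?D x)) (at x)"
    if "x \<in> U" for x
    using B.FDERIV[OF f(1)[OF that] g(1)[OF that]]
    by (simp add: plus_blinfun.rep_eq blinfun_compose.rep_eq o_def B.prod_left.rep_eq B.prod_right.rep_eq)
  ultimately show ?thesis
    unfolding C1_on_def by (intro exI[of _ ?D]) blast
qed

text \<open>\<open>C1_on\<close> demands a continuous derivative, and the derivative of a local
  inverse is the pointwise inverse of a continuous family of operators. Continuity comes from
  \<open>G z - G y = G z (F y - F z) G y\<close> once \<open>norm (G z)\<close> is known to stay
  bounded near \<open>y\<close>.\<close>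

lemma continuous_on_blinfun_inverse:
  fixes F :: "'c::topological_space \<Rightarrow> 'a::real_normed_vector \<Rightarrow>\<^sub>L 'b::real_normed_vector"
  assumes F: "continuous_on V F"
    and inv1: "\<And>y. y \<in> V \<Longrightarrow> G y o\<^sub>L F y = id_blinfun"
    and inv2: "\<And>y. y \<in> V \<Longrightarrow> F y o\<^sub>L G y = id_blinfun"
  shows "continuous_on V G"
  unfolding continuous_on_def
proof
  fix y assume y: "y \<in> V"
  let ?e = "\<lambda>z. norm (F y - F z)"
  have diff: "norm (G z - G y) \<le> norm (G z) * (?e z * norm (G y))" if z: "z \<in> V" for z
  proof -
    have "G z - G y = G z o\<^sub>L ((F y - F z) o\<^sub>L G y)"
    proof (rule blinfun_eqI)
      fix v
      have "F y (G y v) = v"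
        using inv2[OF y] by (metis blinfun_apply_blinfun_compose blinfun_apply_id_blinfun)
      moreover have "G z (F z (G y v)) = G y v"
        using inv1[OF z] by (metis blinfun_apply_blinfun_compose blinfun_apply_id_blinfun)
      ultimately show "(G z - G y) v = (G z o\<^sub>L ((F y - F z) o\<^sub>L G y)) v"
        by (simp add: blinfun.diff_left blinfun.diff_right)
    qed
    then have "norm (G z - G y) \<le> norm (G z) * norm ((F y - F z) o\<^sub>L G y)"
      by (metis norm_blinfun_compose)
    also have "\<dots> \<le> norm (G z) * (?e z * norm (G y))"
      by (intro mult_left_mono norm_blinfun_compose norm_ge_zero)
    finally show ?thesis .
  qed
  have e0: "(?e \<longlongrightarrow> 0) (at y within V)"
  proof -
    have "((\<lambda>z. F y - F z) \<longlongrightarrow> F y - F y) (at y within V)"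
      using F y unfolding continuous_on_def by (intro tendsto_intros) auto
    then show ?thesis by (simp add: tendsto_norm_zero_iff)
  qed
  have "((\<lambda>z. ?e z * norm (G y)) \<longlongrightarrow> 0) (at y within V)"
    using tendsto_mult_right[OF e0, of "norm (G y)"] by (simp add: mult.commute)
  \<comment> \<open>Below 1/2 this factor makes \<open>norm (G z - G y)\<close> at most half of
    \<open>norm (G z)\<close>, which can be absorbed to give
    \<open>norm (G z) \<le> 2 * norm (G y)\<close>. No bound on \<open>G\<close> is assumed
    beforehand.\<close>
  then have "\<forall>\<^sub>F z in at y within V. ?e z * norm (G y) < 1/2"
    by (rule order_tendstoD) simp
  moreover have "\<forall>\<^sub>F z in at y within V. z \<in> V"
    by (simp add: eventually_at_filter)
  ultimately have ev: "\<forall>\<^sub>F z in at y within V.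
      norm (G z - G y) \<le> 2 * norm (G y) * (?e z * norm (G y))"
  proof eventually_elim
    case (elim z)
    have "norm (G z) \<le> norm (G z - G y) + norm (G y)"
      by (metis norm_triangle_sub add.commute)
    also have "norm (G z - G y) \<le> norm (G z) * (1/2)"
      using diff[OF elim(2)] mult_left_mono[of "?e z * norm (G y)" "1/2" "norm (G z)"] elim(1)
      by auto
    finally have "norm (G z) \<le> 2 * norm (G y)" by simp
    then show ?case
      using diff[OF elim(2)] mult_right_mono[of "norm (G z)" "2 * norm (G y)" "?e z * norm (G y)"]
      by auto
  qed
  have "((\<lambda>z. 2 * norm (G y) * (?e z * norm (G y))) \<longlongrightarrow> 0) (at y within V)"
    using tendsto_mult_left[OF \<open>((\<lambda>z. ?e z * norm (G y)) \<longlongrightarrow> 0) (at y within V)\<close>,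
        of "2 * norm (G y)"] by simp
  then have "((\<lambda>z. G z - G y) \<longlongrightarrow> 0) (at y within V)"
    using ev by (rule Lim_null_comparison[rotated])
  then show "(G \<longlongrightarrow> G y) (at y within V)"
    by (simp add: LIM_zero_iff)
qed

text \<open>The inverse function theorem normalised to derivative identity at \<open>x0\<close>, so
  that the inverse has derivative identity as well. Both the slice charts and the parametrization of
  unitary matrices are arranged to fit this case.\<close>

lemma C1_local_inverse:
  fixes f :: "'a::euclidean_space \<Rightarrow> 'a"
  assumes U: "open U" "x0 \<in> U" and f: "C1_on U f"
    and der: "(f has_derivative (\<lambda>x. x)) (at x0)"
  obtains U' V g where "open U'" "U' \<subseteq> U" "x0 \<in> U'" "open V" "homeomorphism U' V f g"
    "C1_on U' f" "C1_on V g" "(g has_derivative (\<lambda>x. x)) (at (f x0))"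
proof -
  from f obtain f' where
    f': "\<And>x. x \<in> U \<Longrightarrow> (f has_derivative blinfun_apply (f' x)) (at x)" "continuous_on U f'"
    unfolding C1_on_def by blast
  have "blinfun_apply (f' x0) = (\<lambda>x. x)"
    using has_derivative_unique[OF f'(1)[OF U(2)] der] by simp
  then have id: "f' x0 = id_blinfun"
    by (intro blinfun_eqI) simp
  then have "id_blinfun o\<^sub>L f' x0 = id_blinfun"
    by (intro blinfun_eqI) simp
  note inv = inverse_function_theorem[OF U(1) f' U(2) this]
  obtain U' V g g' where *: "open U'" "U' \<subseteq> U" "x0 \<in> U'" "open V" "f x0 \<in> V"
    "homeomorphism U' V f g"
    "\<And>y. y \<in> V \<Longrightarrow> (g has_derivative g' y) (at y)"
    "\<And>y. y \<in> V \<Longrightarrow> g' y = inv (blinfun_apply (f' (g y)))"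
    "\<And>y. y \<in> V \<Longrightarrow> bij (blinfun_apply (f' (g y)))"
    by (rule inv) (assumption, rule that)
  have bl: "bounded_linear (g' y)" if "y \<in> V" for y
    using *(7)[OF that] by (rule has_derivative_bounded_linear)
  have app: "blinfun_apply (Blinfun (g' y)) = g' y" if "y \<in> V" for y
    using bl[OF that] by (rule bounded_linear_Blinfun_apply)
  have "continuous_on V g" "g ` V \<subseteq> U"
    using *(6) *(2) by (auto simp: homeomorphism_def)
  then have "continuous_on V (\<lambda>y. f' (g y))"
    using continuous_on_compose2[OF f'(2)] by blast
  then have cg: "continuous_on V (\<lambda>y. Blinfun (g' y))"
  proof (rule continuous_on_blinfun_inverse)
    fix y assume y: "y \<in> V"
    show "Blinfun (g' y) o\<^sub>L f' (g y) = id_blinfun"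
      using *(9)[OF y] by (intro blinfun_eqI) (simp add: app[OF y], simp add: *(8)[OF y] bij_is_inj)
    show "f' (g y) o\<^sub>L Blinfun (g' y) = id_blinfun"
      using *(9)[OF y]
      by (intro blinfun_eqI) (simp add: app[OF y], simp add: *(8)[OF y] bij_is_surj surj_f_inv_f)
  qed
  have "C1_on V g"
    unfolding C1_on_def using cg *(7) app by (intro exI[of _ "\<lambda>y. Blinfun (g' y)"]) auto
  moreover have "(g has_derivative (\<lambda>x. x)) (at (f x0))"
  proof -
    have "g (f x0) = x0" using *(3,6) by (auto simp: homeomorphism_def)
    then have "g' (f x0) = inv (\<lambda>x. x)"
      using *(8)[OF *(5)] id by (simp add: id_blinfun.rep_eq)
    also have "\<dots> = (\<lambda>x. x)" by (rule inv_id[unfolded id_def])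
    finally show ?thesis using *(7)[OF *(5)] by simp
  qed
  ultimately show thesis
    using that * C1_on_subset[OF f *(2)] by blast
qed

subsection \<open>Submanifolds and dimension\<close>

text \<open>The source of all lower bounds. With \<open>p\<close> a linear projection onto
  \<open>W\<close>, the map \<open>F (p z) + (z - p z)\<close> agrees with \<open>F\<close> on
  \<open>W\<close> and has derivative identity at 0, so it is a local diffeomorphism of the ambient
  space. Its inverse is a slice chart for the image of \<open>W\<close>, and this one chart serves
  every point.\<close>

lemma submanifold_immersion:
  fixes W :: "'a::euclidean_space set"
  assumes W: "subspace W" and Om: "open Om" "0 \<in> Om" and F: "C1_on Om F"
    and F': "(F has_derivative F') (at 0)" and id: "\<And>x. x \<in> W \<Longrightarrow> F' x = x"
    and FS: "\<And>x. x \<in> W \<inter> Om \<Longrightarrow> F x \<in> S"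
  shows "\<exists>M. M \<noteq> {} \<and> M \<subseteq> S \<and> submanifold (dim W) M"
proof -
  obtain p :: "'a \<Rightarrow> 'a" where p: "linear p" "\<And>x. p x \<in> W" "\<And>x. x \<in> W \<Longrightarrow> p x = x"
    using linear_exists_left_inverse_on[OF linear_id W] by auto
  have bp: "bounded_linear p" using p(1) by (simp add: linear_conv_bounded_linear)
  have p0: "p 0 = 0" using p(1) by (rule linear_0)
  let ?Phi = "\<lambda>z. F (p z) + (z - p z)"
  have "open (p -` Om)"
    using Om(1) bp by (intro open_vimage linear_continuous_on)
  moreover have "0 \<in> p -` Om" using Om(2) p0 by simp
  moreover have "C1_on (p -` Om) ?Phi"
    by (intro C1_on_add C1_on_compose[OF C1_on_bounded_linear[OF bp] F] C1_on_bounded_linear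
        bounded_linear_sub bounded_linear_ident bp) auto
  moreover have "(?Phi has_derivative (\<lambda>z. z)) (at 0)"
  proof -
    have dp: "(p has_derivative p) (at 0)" using bp by (rule bounded_linear_imp_has_derivative)
    have "((\<lambda>z. F (p z)) has_derivative (\<lambda>z. F' (p z))) (at 0)"
      by (rule has_derivative_compose[OF dp]) (simp add: p0 F')
    then have "(?Phi has_derivative (\<lambda>z. F' (p z) + (z - p z))) (at 0)"
      by (intro has_derivative_add has_derivative_diff has_derivative_ident dp)
    then show ?thesis by (simp add: id p(2))
  qed
  ultimately obtain U' V g where g: "open U'" "U' \<subseteq> p -` Om" "0 \<in> U'" "open V"
    "homeomorphism U' V ?Phi g" "C1_on U' ?Phi" "C1_on V g"
    by (rule C1_local_inverse)
  let ?M = "?Phi ` (W \<inter> U')"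
  have "?M \<noteq> {}" using subspace_0[OF W] g(3) by blast
  moreover have "?M \<subseteq> S"
    using FS p(3) g(2) by fastforce
  moreover have "submanifold (dim W) ?M"
    unfolding submanifold_def
  proof
    fix q assume q: "q \<in> ?M"
    have qV: "q \<in> V" using q g(5) by (auto simp: homeomorphism_def)
    have sym: "homeomorphism V U' g ?Phi" using g(5) by (rule homeomorphism_symD)
    have "?M \<inter> V = ?M" using g(5) by (auto simp: homeomorphism_def)
    moreover have "g (?Phi x) = x" if "x \<in> U'" for x
      by (rule homeomorphism_apply1[OF g(5) that])
    then have "g ` ?M = W \<inter> U'" unfolding image_image
      by (subst image_cong[where g = "\<lambda>x. x"]) auto
    ultimately have "g ` (?M \<inter> V) = W \<inter> U'" by simp
    then show "\<exists>U V h g L. open U \<and> q \<in> U \<and> open V \<and> homeomorphism U V h g \<and> C1_on U h \<and>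
        C1_on V g \<and> subspace L \<and> dim L = dim W \<and> h ` (?M \<inter> U) = L \<inter> V"
      using g qV sym W
      by - (rule exI[of _ V], rule exI[of _ U'], rule exI[of _ g], rule exI[of _ ?Phi],
          rule exI[of _ W], intro conjI refl)
  qed
  ultimately show ?thesis by (intro exI[of _ ?M] conjI)
qed

text \<open>\<open>T\<close> is the image of the slice \<open>L\<close> under the derivative of the
  inverse chart \<open>g\<close>, and the curves are images under \<open>g\<close> of straight lines
  in \<open>L\<close>. The dimension is preserved because \<open>h (g x) = x\<close> makes that
  derivative injective.\<close>

lemma submanifold_tangent:
  fixes M :: "'a::euclidean_space set"
  assumes "submanifold d M" "p \<in> M"
  obtains T where "subspace T" "dim T = d"
    "\<And>X. X \<in> T \<Longrightarrow> \<exists>\<gamma> :: real \<Rightarrow> 'a. \<gamma> 0 = p \<and> (\<gamma> has_vector_derivative X) (at 0) \<and>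
       (\<forall>\<^sub>F t in at 0. \<gamma> t \<in> M)"
proof -
  obtain U V h g L where UV: "open U" "p \<in> U" "open V" "homeomorphism U V h g"
    and "C1_on U h" "C1_on V g" and L: "subspace L" "dim L = d" "h ` (M \<inter> U) = L \<inter> V"
    using bspec[OF assms(1)[unfolded submanifold_def] assms(2)] by (elim exE conjE) (rule that)
  let ?y = "h p"
  have y: "?y \<in> L \<inter> V" using L(3) assms(2) UV(2) by blast
  have gh: "g (h x) = x" if "x \<in> U" for x using UV(4) that by (auto simp: homeomorphism_def)
  have hg: "h (g x) = x" if "x \<in> V" for x using UV(4) that by (auto simp: homeomorphism_def)
  obtain h' where h': "(h has_derivative h') (at p)"
    using \<open>C1_on U h\<close> UV(2) unfolding C1_on_def by blast
  obtain g' where g': "(g has_derivative g') (at ?y)"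
    using \<open>C1_on V g\<close> y unfolding C1_on_def by blast
  have lin: "linear g'" using g' has_derivative_linear by blast
  have "((\<lambda>x. h (g x)) has_derivative (\<lambda>v. h' (g' v))) (at ?y)"
    using gh[OF UV(2)] h' by (intro has_derivative_compose[OF g']) simp
  then have "((\<lambda>x. x) has_derivative (\<lambda>v. h' (g' v))) (at ?y)"
    by (rule has_derivative_transform_within_open[OF _ UV(3)]) (use y hg in auto)
  then have "h' (g' v) = v" for v
    by (metis has_derivative_unique[OF _ has_derivative_ident])
  then have inj: "inj g'" by (rule inj_on_inverseI)
  show thesis
  proof
    show "subspace (g' ` L)" using lin L(1) by (rule linear_subspace_image)
    show "dim (g' ` L) = d"
      using dim_image_eq[OF lin] inj L(2) by (metis inj_on_subset subset_UNIV)
    fix X assume "X \<in> g' ` L"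
    then obtain v where v: "v \<in> L" "X = g' v" by blast
    let ?c = "\<lambda>t. ?y + t *\<^sub>R v"
    let ?\<gamma> = "\<lambda>t. g (?c t)"
    have dc: "(?c has_derivative (\<lambda>t. t *\<^sub>R v)) (at 0)"
      by (auto intro!: derivative_eq_intros)
    have "(?\<gamma> has_derivative (\<lambda>t. g' (t *\<^sub>R v))) (at 0)"
      by (rule has_derivative_compose[OF dc]) (simp add: g')
    then have "(?\<gamma> has_vector_derivative X) (at 0)"
      unfolding has_vector_derivative_def v(2) linear_scale[OF lin] .
    moreover have "\<forall>\<^sub>F t in at 0. ?\<gamma> t \<in> M"
    proof -
      have "(?c \<longlongrightarrow> ?y + 0 *\<^sub>R v) (at 0)" by (intro tendsto_intros)
      then have "\<forall>\<^sub>F t in at 0. ?c t \<in> V"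
        using UV(3) y by (intro topological_tendstoD) auto
      then show ?thesis
      proof eventually_elim
        case (elim t)
        have "?c t \<in> L" using L(1) y v(1) by (simp add: subspace_add subspace_scale)
        with elim have "?c t \<in> h ` (M \<inter> U)" using L(3) by blast
        then show ?case using gh by force
      qed
    qed
    ultimately show "\<exists>\<gamma> :: real \<Rightarrow> 'a. \<gamma> 0 = p \<and> (\<gamma> has_vector_derivative X) (at 0) \<and>
       (\<forall>\<^sub>F t in at 0. \<gamma> t \<in> M)"
      using gh[OF UV(2)] by (intro exI[of _ ?\<gamma>]) simp
  qed
qed

text \<open>The upper bound does double duty: it also makes the set of dimensions finite, as
  \<open>Max\<close> requires.\<close>

lemma real_dim_eqI:
  fixes S :: "'a::euclidean_space set"
  assumes "\<exists>M. M \<noteq> {} \<and> M \<subseteq> S \<and> submanifold d M"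
    and "\<And>e M. M \<noteq> {} \<Longrightarrow> M \<subseteq> S \<Longrightarrow> submanifold e M \<Longrightarrow> e \<le> d"
  shows "real_dim S = int d"
proof -
  have "Max {d. \<exists>M. M \<noteq> {} \<and> M \<subseteq> S \<and> submanifold d M} = d"
  proof (rule Max_eqI)
    show "finite {d. \<exists>M. M \<noteq> {} \<and> M \<subseteq> S \<and> submanifold d M}"
      by (rule finite_subset[of _ "{..d}"]) (use assms(2) in auto)
  qed (use assms in auto)
  moreover have "S \<noteq> {}" using assms(1) by blast
  ultimately show ?thesis by (simp add: real_dim_def)
qed

subsection \<open>Unitary diagonalization of normal matrices\<close>

lemma conj_transpose_conj_transpose [simp]: "conj_transpose (conj_transpose A) = A"
  by (simp add: conj_transpose_def vec_eq_iff)

lemma conj_transpose_mul: "conj_transpose (A ** B) = conj_transpose B ** conj_transpose A"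
  by (simp add: conj_transpose_def vec_eq_iff matrix_matrix_mult_def mult.commute)

lemma conj_transpose_mat_1 [simp]: "conj_transpose (mat 1) = mat 1"
  by (auto simp: conj_transpose_def vec_eq_iff mat_def)

lemma conj_transpose_add: "conj_transpose (A + B) = conj_transpose A + conj_transpose B"
  by (simp add: conj_transpose_def vec_eq_iff)

lemma conj_transpose_diff: "conj_transpose (A - B) = conj_transpose A - conj_transpose B"
  by (simp add: conj_transpose_def vec_eq_iff)

lemma conj_transpose_scaleR: "conj_transpose (r *\<^sub>R A) = r *\<^sub>R conj_transpose A"
  by (simp add: conj_transpose_def vec_eq_iff)

lemma bounded_linear_conj_transpose:
  "bounded_linear (conj_transpose :: complex^'n^'m \<Rightarrow> complex^'m^'n)"
  by (intro linear_conv_bounded_linear[THEN iffD1] linearI conj_transpose_add conj_transpose_scaleR)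

definition diag_mat :: "('n \<Rightarrow> 'a::zero) \<Rightarrow> 'a^'n^'n" where
  "diag_mat d = (\<chi> i j. if i = j then d i else 0)"

lemma diag_mat_nth: "diag_mat d $ i $ j = (if i = j then d i else 0)"
  by (simp add: diag_mat_def)

lemma diag_mat_mult_vec: "(diag_mat d *v v) $ i = d i * (v :: 'a::semiring_1^'n) $ i"
  by (simp add: matrix_vector_mult_def diag_mat_nth if_distrib[of "\<lambda>x. x * _"] cong: if_cong)

lemma diag_mat_mult_nth: "(diag_mat d ** (M :: 'a::semiring_1^'n^'n)) $ i $ j = d i * M $ i $ j"
  by (simp add: matrix_matrix_mult_def diag_mat_nth if_distrib[of "\<lambda>x. x * _"] cong: if_cong)

lemma mult_diag_mat_nth: "((M :: 'a::semiring_1^'n^'n) ** diag_mat d) $ i $ j = M $ i $ j * d j"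
  by (simp add: matrix_matrix_mult_def diag_mat_nth if_distrib[of "\<lambda>x. _ * x"] cong: if_cong)

lemma conj_transpose_diag_mat: "conj_transpose (diag_mat d) = diag_mat (\<lambda>i. cnj (d i))"
  by (auto simp: conj_transpose_def vec_eq_iff diag_mat_nth)

lemma matrix_mult_diff_right: "(A :: 'a::ring_1^'n^'m) ** (B - C) = A ** B - A ** C"
  by (simp add: vec_eq_iff matrix_matrix_mult_def sum_subtractf right_diff_distrib)

lemma matrix_mult_diff_left: "((A :: 'a::ring_1^'n^'m) - B) ** C = A ** C - B ** C"
  by (simp add: vec_eq_iff matrix_matrix_mult_def sum_subtractf left_diff_distrib)

definition unitary :: "complex^'n^'n \<Rightarrow> bool" where
  "unitary U \<longleftrightarrow> U ** conj_transpose U = mat 1"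

lemma unitaryD:
  assumes "unitary U"
  shows "U ** conj_transpose U = mat 1" "conj_transpose U ** U = mat 1"
  using assms matrix_left_right_inverse unfolding unitary_def by blast+

text \<open>The Hermitian inner product, conjugate-linear in the first argument. The
  \<open>inner\<close> of the type is only its real part and does not express complex
  orthogonality.\<close>

definition hdot :: "complex^'n \<Rightarrow> complex^'n \<Rightarrow> complex" where
  "hdot u v = (\<Sum>i\<in>UNIV. cnj (u $ i) * v $ i)"

lemma hdot_self: "hdot v v = of_real ((norm v)\<^sup>2)"
  by (simp add: hdot_def norm_vec_def L2_set_def sum_nonneg complex_norm_square mult.commute
      del: of_real_power)

lemma hdot_adjoint: "hdot u (A *v v) = hdot (conj_transpose A *v u) v"
proof -
  have "hdot u (A *v v) = (\<Sum>i\<in>UNIV. \<Sum>j\<in>UNIV. cnj (u $ i) * (A $ i $ j * v $ j))"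
    by (simp add: hdot_def matrix_vector_mult_def sum_distrib_left)
  also have "\<dots> = (\<Sum>j\<in>UNIV. \<Sum>i\<in>UNIV. cnj (u $ i) * (A $ i $ j * v $ j))"
    by (rule sum.swap)
  also have "\<dots> = hdot (conj_transpose A *v u) v"
    by (simp add: hdot_def matrix_vector_mult_def conj_transpose_def sum_distrib_left
        sum_distrib_right mult_ac)
  finally show ?thesis .
qed

lemma hdot_scale_left: "hdot (c *s u) v = cnj c * hdot u v"
  by (simp add: hdot_def sum_distrib_left mult_ac)

lemma hdot_scale_right: "hdot u (c *s v) = c * hdot u v"
  by (simp add: hdot_def sum_distrib_left mult_ac)

lemma hdot_add_right: "hdot u (v + w) = hdot u v + hdot u w"
  by (simp add: hdot_def sum.distrib algebra_simps)

lemma hdot_zero_right: "hdot u 0 = 0"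
  by (simp add: hdot_def)

lemma hdot_commute: "hdot u v = cnj (hdot v u)"
  by (simp add: hdot_def mult.commute)

text \<open>With \<open>N = A - mat c\<close>, normality gives
  \<open>N *v (conj_transpose N *v v) = 0\<close>, hence the norm of
  \<open>conj_transpose N *v v\<close> vanishes. This makes the orthogonal complement of
  eigenvectors of \<open>A\<close> invariant under \<open>A\<close>.\<close>

lemma normal_eigenvector_conj_transpose:
  assumes A: "normal_matrix A" and v: "A *v v = c *s v"
  shows "conj_transpose A *v v = cnj c *s v"
proof -
  define N where "N = A - mat c"
  have ctN: "conj_transpose N = conj_transpose A - mat (cnj c)"
    by (auto simp: N_def conj_transpose_def vec_eq_iff mat_def)
  have matv: "mat x *v w = x *s w" for x :: complex and w :: "complex^'a"
    by (simp add: matrix_vector_mult_def mat_def vec_eq_iff if_distrib[of "\<lambda>x. x * _"] cong: if_cong)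
  have comm: "mat x ** M = M ** mat x" for x :: complex and M :: "complex^'a^'a"
    by (simp add: matrix_matrix_mult_def mat_def vec_eq_iff if_distrib[of "\<lambda>x. x * _"]
        if_distrib[of "\<lambda>x. _ * x"] mult.commute cong: if_cong)
  have "conj_transpose N ** N = N ** conj_transpose N"
    using A unfolding normal_matrix_def ctN unfolding N_def
    by (simp add: matrix_mult_diff_left matrix_mult_diff_right comm[of "cnj c" A]
        comm[of c "conj_transpose A"] comm[of "cnj c" "mat c"])
  moreover have "N *v v = 0"
    by (simp add: N_def matrix_vector_mult_diff_rdistrib v matv)
  ultimately have "N *v (conj_transpose N *v v) = 0"
    by (metis matrix_vector_mul_assoc matrix_vector_mult_0_right)
  then have "hdot (conj_transpose N *v v) (conj_transpose N *v v) = 0"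
    by (metis hdot_adjoint conj_transpose_conj_transpose hdot_commute hdot_zero_right complex_cnj_zero)
  then have "conj_transpose N *v v = 0"
    by (simp add: hdot_self)
  then show ?thesis
    by (simp add: ctN matrix_vector_mult_diff_rdistrib matv)
qed

text \<open>This is p(A) v, evaluated by Horner's scheme.\<close>

definition poly_apply :: "complex^'n^'n \<Rightarrow> complex^'n \<Rightarrow> complex poly \<Rightarrow> complex^'n" where
  "poly_apply A v p = fold_coeffs (\<lambda>a w. a *s v + A *v w) p 0"

lemma poly_apply_0 [simp]: "poly_apply A v 0 = 0"
  by (simp add: poly_apply_def)

lemma poly_apply_pCons [simp]: "poly_apply A v (pCons a p) = a *s v + A *v poly_apply A v p"
  by (cases "p = 0 \<and> a = 0") (auto simp: poly_apply_def)

lemma poly_apply_add: "poly_apply A v (p + q) = poly_apply A v p + poly_apply A v q"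
  by (induction p q rule: poly_induct2) (simp_all add: vec.scale_left_distrib matrix_vector_right_distrib)

lemma poly_apply_smult: "poly_apply A v (smult c p) = c *s poly_apply A v p"
  by (induction p) (simp_all add: vec.scale_right_distrib vector_scalar_commute)

lemma poly_apply_diff: "poly_apply A v (p - q) = poly_apply A v p - poly_apply A v q"
  using poly_apply_add[of A v "p - q" q] by simp

lemma poly_apply_sum: "poly_apply A v (\<Sum>i\<in>S. f i) = (\<Sum>i\<in>S. poly_apply A v (f i))"
  by (induction S rule: infinite_finite_induct) (simp_all add: poly_apply_add)

lemma poly_apply_monom: "poly_apply A v (monom c i) = c *s (((*v) A ^^ i) v)"
  by (induction i) (simp_all add: monom_0 monom_Suc vector_scalar_commute)

lemma poly_apply_linear_factor:
  "poly_apply A v ([:- r, 1:] * q) = A *v poly_apply A v q - r *s poly_apply A v q"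
  by (simp add: poly_apply_diff poly_apply_smult)

lemma poly_apply_mem:
  assumes "vec.subspace S" "\<And>w. w \<in> S \<Longrightarrow> A *v w \<in> S" "v \<in> S"
  shows "poly_apply A v p \<in> S"
  by (induction p) (use assms in \<open>auto intro: vec.subspace_0 vec.subspace_add vec.subspace_scale\<close>)

text \<open>The n+1 vectors v, A v, ..., A^n v lie in a space of dimension n; a linear relation
  between them is the polynomial.\<close>

lemma annihilating_poly_exists:
  fixes A :: "complex^'n^'n"
  shows "\<exists>p. p \<noteq> 0 \<and> poly_apply A v p = 0"
proof -
  define x where "x = (\<lambda>i. ((*v) A ^^ i) v)"
  show ?thesis
  \<comment> \<open>Linear dependence is a property of sets of vectors, so a repetition among the
    iterates is invisible to it. A repetition yields a difference of two monomials directly.\<close>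
  proof (cases "inj_on x {..CARD('n)}")
    case False
    then obtain i j where ij: "x i = x j" "i \<noteq> j" by (auto simp: inj_on_def)
    let ?p = "monom 1 i - monom 1 j :: complex poly"
    have "?p \<noteq> 0" using ij(2) by (metis eq_iff_diff_eq_0 monom_eq_iff' zero_neq_one)
    moreover have "poly_apply A v ?p = 0"
      using ij(1) by (simp add: poly_apply_diff poly_apply_monom x_def)
    ultimately show ?thesis by blast
  next
    case True
    have "vec.dependent (x ` {..CARD('n)})"
      by (rule vec.dependent_biggerset_general)
        (simp add: card_image[OF True] le_imp_less_Suc dim_subset_UNIV_cart_gen)
    then obtain c where c: "(\<Sum>w\<in>x ` {..CARD('n)}. c w *s w) = 0" "\<exists>w\<in>x ` {..CARD('n)}. c w \<noteq> 0"
      by (subst (asm) vec.dependent_finite) auto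
    let ?p = "\<Sum>i\<le>CARD('n). monom (c (x i)) i"
    from c(2) obtain i where i: "i \<le> CARD('n)" "c (x i) \<noteq> 0" by auto
    have "coeff ?p i = c (x i)"
      using i(1) by (simp add: coeff_sum)
    then have "?p \<noteq> 0" using i(2) by (metis coeff_0)
    moreover have "poly_apply A v ?p = 0"
      using c(1) by (simp add: poly_apply_sum poly_apply_monom sum.reindex[OF True] flip: x_def)
        (simp add: x_def)
    ultimately show ?thesis by blast
  qed
qed

text \<open>Take an annihilating polynomial of \<open>v\<close> of least degree; it is not constant
  because \<open>v\<close> is nonzero. Splitting off a root \<open>r\<close> leaves \<open>q\<close>
  with q(A) v nonzero by minimality, and this vector is an eigenvector for \<open>r\<close> that
  stays in \<open>S\<close>.\<close>

lemma invariant_subspace_eigenvector: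
  fixes A :: "complex^'n^'n"
  assumes S: "vec.subspace S" "\<And>w. w \<in> S \<Longrightarrow> A *v w \<in> S" and v: "v \<in> S" "v \<noteq> 0"
  obtains w c where "w \<in> S" "w \<noteq> 0" "A *v w = c *s w"
proof -
  let ?P = "\<lambda>p. p \<noteq> 0 \<and> poly_apply A v p = 0"
  define p where "p = arg_min degree ?P"
  have p: "?P p" and min: "\<And>q. ?P q \<Longrightarrow> degree p \<le> degree q"
    using arg_min_natI[of ?P _ degree] arg_min_nat_le[of ?P _ degree] annihilating_poly_exists[of A v]
    unfolding p_def by blast+
  have "degree p \<noteq> 0"
  proof
    assume "degree p = 0"
    then obtain a where "p = [:a:]" by (rule degree_eq_zeroE)
    with p v(2) show False by (simp add: vec.scale_eq_0_iff)
  qed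
  then obtain r where "poly p r = 0"
    using fundamental_theorem_of_algebra constant_degree by metis
  then obtain q where q: "p = [:- r, 1:] * q"
    by (metis poly_eq_0_iff_dvd dvdE)
  with p have "q \<noteq> 0" by auto
  then have "degree p = Suc (degree q)"
    using q by (simp add: degree_mult_eq del: mult_pCons_left)
  with min[of q] \<open>q \<noteq> 0\<close> have "poly_apply A v q \<noteq> 0" by force
  moreover have "A *v poly_apply A v q = r *s poly_apply A v q"
    using p q poly_apply_linear_factor[of A v r q] by simp
  ultimately show thesis
    using that poly_apply_mem[OF S v(1)] by blast
qed

text \<open>The arbitrary index set \<open>J\<close> is there for the induction: while an index is
  missing, the orthogonal complement \<open>S\<close> of the vectors found so far is nonzero and
  \<open>A\<close>-invariant, hence contains another eigenvector.\<close>

lemma orthonormal_eigenvectors: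
  fixes A :: "complex^'n^'n" and J :: "'n set"
  assumes A: "normal_matrix A"
  shows "\<exists>u d. (\<forall>j\<in>J. A *v u j = d j *s u j) \<and>
    (\<forall>i\<in>J. \<forall>j\<in>J. hdot (u i) (u j) = (if i = j then 1 else 0))"
  using finite[of J]
proof (induction J rule: finite_induct)
  case empty
  then show ?case by simp
next
  case (insert k J)
  then obtain u d where u: "\<And>j. j \<in> J \<Longrightarrow> A *v u j = d j *s u j"
    "\<And>i j. i \<in> J \<Longrightarrow> j \<in> J \<Longrightarrow> hdot (u i) (u j) = (if i = j then 1 else 0)" by blast
  \<comment> \<open>The kernel of \<open>N\<close> is the orthogonal complement of the
    \<open>u i\<close> with \<open>i \<in> J\<close>. Padding with zero rows keeps \<open>N\<close>
    square, and row \<open>k\<close> is one of them, so \<open>N\<close> is singular.\<close>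
  define N :: "complex^'n^'n" where "N = (\<chi> i j. if i \<in> J then cnj (u i $ j) else 0)"
  have "row k N = 0" using insert(2) by (simp add: row_def N_def vec_eq_iff)
  then have "det N = 0" by (rule det_zero_row)
  then have "\<not> invertible N" by (simp add: invertible_det_nz)
  then obtain x where x: "x \<noteq> 0" "N *v x = 0"
    unfolding invertible_left_inverse matrix_left_invertible_ker by blast
  define S where "S = {y. \<forall>j\<in>J. hdot (u j) y = 0}"
  have "vec.subspace S"
    by (auto simp: vec.subspace_def S_def hdot_zero_right hdot_add_right hdot_scale_right)
  moreover have "A *v y \<in> S" if "y \<in> S" for y
    using that by (auto simp: S_def hdot_adjoint hdot_scale_left
        normal_eigenvector_conj_transpose[OF A u(1)])
  moreover have "x \<in> S"
  proof -
    have "hdot (u j) x = (N *v x) $ j" if "j \<in> J" for j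
      using that by (simp add: hdot_def N_def matrix_vector_mult_def)
    then show ?thesis using x(2) by (simp add: S_def)
  qed
  ultimately obtain w c where w: "w \<in> S" "w \<noteq> 0" "A *v w = c *s w"
    using invariant_subspace_eigenvector x(1) by metis
  define w' where "w' = complex_of_real (inverse (norm w)) *s w"
  have "hdot w' w' = 1"
  proof -
    have "hdot w' w' = complex_of_real (inverse (norm w)) * (complex_of_real (inverse (norm w)) * hdot w w)"
      by (simp only: w'_def hdot_scale_left hdot_scale_right complex_cnj_complex_of_real)
    then show ?thesis using w(2) by (simp add: hdot_self power2_eq_square field_simps)
  qed
  moreover have "hdot (u j) w' = 0" "hdot w' (u j) = 0" if "j \<in> J" for j
    using that w(1) hdot_commute[of w' "u j"] by (auto simp: S_def w'_def hdot_scale_right)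
  moreover have "A *v w' = c *s w'"
    using w(3) by (simp add: w'_def vector_scalar_commute vec.scale_left_commute)
  ultimately show ?case
    using insert(2) u
    by (intro exI[of _ "u(k := w')"] exI[of _ "d(k := c)"]) auto
qed

lemma normal_unitarily_diagonalizable:
  fixes A :: "complex^'n^'n"
  assumes "normal_matrix A"
  obtains U d where "unitary U" "A = U ** diag_mat d ** conj_transpose U"
proof -
  obtain u :: "'n \<Rightarrow> complex^'n" and d where
    "\<forall>j. A *v u j = d j *s u j" "\<forall>i j. hdot (u i) (u j) = (if i = j then 1 else 0)"
    using orthonormal_eigenvectors[OF assms, of UNIV] unfolding ball_UNIV by (elim exE conjE) (rule that, assumption, assumption)
  note u = this[rule_format]
  define U :: "complex^'n^'n" where "U = (\<chi> i j. u j $ i)"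
  have "conj_transpose U ** U = mat 1"
    using u(2) by (simp add: vec_eq_iff conj_transpose_def U_def matrix_matrix_mult_def hdot_def mat_def)
  then have U: "unitary U" using matrix_left_right_inverse unfolding unitary_def by blast
  have "(A ** U) $ i $ j = (U ** diag_mat d) $ i $ j" for i j
    using arg_cong[OF u(1)[of j], of "\<lambda>v. v $ i"]
    by (simp add: mult_diag_mat_nth) (simp add: U_def matrix_matrix_mult_def matrix_vector_mult_def)
  then have "A ** U = U ** diag_mat d" by (simp add: vec_eq_iff)
  then have "U ** diag_mat d ** conj_transpose U = A"
    using unitaryD(1)[OF U] by (metis matrix_mul_assoc matrix_mul_rid)
  with U that show thesis by blast
qed

lemma normal_unitary_diag:
  assumes "unitary U"
  shows "normal_matrix (U ** diag_mat d ** conj_transpose U)"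
proof -
  have "U ** X ** conj_transpose U ** (U ** Y ** conj_transpose U) = U ** (X ** Y) ** conj_transpose U"
    for X Y using unitaryD(2)[OF assms] by (metis matrix_mul_assoc matrix_mul_rid)
  moreover have "diag_mat d ** diag_mat e = diag_mat e ** diag_mat d" for e :: "'a \<Rightarrow> complex"
    by (auto simp: vec_eq_iff diag_mat_mult_nth diag_mat_nth)
  moreover have "conj_transpose (U ** diag_mat d ** conj_transpose U)
      = U ** diag_mat (\<lambda>i. cnj (d i)) ** conj_transpose U"
    by (simp add: conj_transpose_mul conj_transpose_diag_mat matrix_mul_assoc)
  ultimately show ?thesis
    by (simp add: normal_matrix_def)
qed

section \<open>Spectrum and multiplicities read off from a unitary diagonalization\<close>

lemma unitary_mult_vec_eq_0:
  assumes "unitary U"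
  shows "conj_transpose U *v v = 0 \<longleftrightarrow> v = 0"
  by (metis assms matrix_vector_mul_assoc matrix_vector_mul_lid matrix_vector_mult_0_right unitaryD(1))

lemma eigenvalues_unitary_diag:
  fixes U :: "complex^'n^'n"
  assumes U: "unitary U"
  shows "eigenvalues (U ** diag_mat d ** conj_transpose U) = range d"
proof (intro set_eqI iffI)
  fix c assume "c \<in> eigenvalues (U ** diag_mat d ** conj_transpose U)"
  then obtain v where v: "v \<noteq> 0" "(U ** diag_mat d ** conj_transpose U) *v v = c *s v"
    by (auto simp: eigenvalues_def)
  let ?w = "conj_transpose U *v v"
  have "diag_mat d *v ?w = conj_transpose U *v ((U ** diag_mat d ** conj_transpose U) *v v)"
    using unitaryD(2)[OF U] by (metis matrix_vector_mul_assoc matrix_vector_mul_lid)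
  then have "diag_mat d *v ?w = c *s ?w" by (simp add: v(2) vector_scalar_commute)
  then have "d i * ?w $ i = c * ?w $ i" for i
    by (metis diag_mat_mult_vec vector_smult_component)
  moreover have "?w \<noteq> 0" using v(1) unitary_mult_vec_eq_0[OF U] by blast
  ultimately show "c \<in> range d"
    by (metis mult_right_cancel rangeI vec_eq_iff zero_index)
next
  fix c assume "c \<in> range d"
  then obtain i where i: "c = d i" by blast
  let ?w = "axis i 1 :: complex^'n"
  have "diag_mat d *v ?w = c *s ?w"
    by (auto simp: vec_eq_iff diag_mat_mult_vec i axis_def)
  then have "(U ** diag_mat d ** conj_transpose U) *v (U *v ?w) = c *s (U *v ?w)"
    using unitaryD(2)[OF U]
    by (metis matrix_vector_mul_assoc matrix_vector_mul_lid vector_scalar_commute)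
  moreover have "U *v ?w \<noteq> 0"
    using unitaryD(2)[OF U]
    by (metis axis_eq_0_iff matrix_vector_mul_assoc matrix_vector_mul_lid matrix_vector_mult_0_right zero_neq_one)
  ultimately show "c \<in> eigenvalues (U ** diag_mat d ** conj_transpose U)"
    by (auto simp: eigenvalues_def)
qed

text \<open>The similarity is carried over to matrices of polynomials: the entrywise embedding
  \<open>P\<close> of constants is multiplicative, and \<open>N M\<close> is
  \<open>mat [:0, 1:] - P M\<close>. Taking determinants, the nonzero \<open>det (P U)\<close>
  cancels in the integral domain of polynomials.\<close>

lemma char_poly_unitary_diag:
  fixes U :: "complex^'n^'n"
  assumes U: "unitary U"
  shows "char_poly (U ** diag_mat d ** conj_transpose U) = (\<Prod>i\<in>UNIV. [:- d i, 1:])"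
proof -
  let ?A = "U ** diag_mat d ** conj_transpose U"
  define P :: "complex^'n^'n \<Rightarrow> complex poly^'n^'n" where "P = (\<lambda>M. \<chi> i j. [:M $ i $ j:])"
  define N :: "complex^'n^'n \<Rightarrow> complex poly^'n^'n" where
    "N = (\<lambda>M. \<chi> i j. (if i = j then [:0, 1:] else 0) - [:M $ i $ j:])"
  have sumC: "(\<Sum>i\<in>S. [:f i:]) = [:\<Sum>i\<in>S. f i:]" for S and f :: "'n \<Rightarrow> complex"
    by (induction S rule: infinite_finite_induct) auto
  have PP: "P (X ** Y) = P X ** P Y" for X Y
    by (simp add: P_def vec_eq_iff matrix_matrix_mult_def mult.commute flip: sumC)
  have "P U ** P (conj_transpose U) = mat 1"
    unfolding PP[symmetric] unitaryD(1)[OF U] by (simp add: P_def vec_eq_iff mat_def one_pCons)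
  then have "det (P U) * det (P (conj_transpose U)) = 1" by (metis det_mul det_I)
  then have nz: "det (P U) \<noteq> 0" by auto
  have NE: "N M = mat [:0, 1:] - P M" for M
    by (simp add: N_def P_def vec_eq_iff mat_def)
  have "mat x ** M = M ** mat x" for x and M :: "complex poly^'n^'n"
    by (simp add: matrix_matrix_mult_def mat_def vec_eq_iff if_distrib[of "\<lambda>x. x * _"]
        if_distrib[of "\<lambda>x. _ * x"] mult.commute cong: if_cong)
  moreover have "U ** diag_mat d = ?A ** U"
    using unitaryD(2)[OF U] by (metis matrix_mul_assoc matrix_mul_rid)
  ultimately have "P U ** N (diag_mat d) = N ?A ** P U"
    unfolding NE matrix_mult_diff_left matrix_mult_diff_right PP[symmetric] by simp
  then have "det (P U) * det (N (diag_mat d)) = det (N ?A) * det (P U)" by (metis det_mul)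
  with nz have "det (N ?A) = det (N (diag_mat d))" by simp
  also have "\<dots> = (\<Prod>i\<in>UNIV. N (diag_mat d) $ i $ i)"
    by (rule det_diagonal) (simp add: N_def diag_mat_nth)
  finally show ?thesis
    by (simp add: char_poly_def N_def diag_mat_nth)
qed

lemma multiplicity_unitary_diag:
  fixes U :: "complex^'n^'n"
  assumes U: "unitary U"
  shows "multiplicity_of_eigenvalue (U ** diag_mat d ** conj_transpose U) c = card {i. d i = c}"
proof -
  have lin: "order c [:- a, 1:] = (if a = c then 1 else 0)" for a
    using order_power_n_n[of c 1] by (auto intro: order_0I)
  have "order c (\<Prod>i\<in>S. [:- d i, 1:]) = card {i\<in>S. d i = c}" for S
    using finite[of S]
  proof (induction S rule: finite_induct)
    case (insert a S)
    have "{i \<in> insert a S. d i = c} = (if d a = c then insert a {i\<in>S. d i = c} else {i\<in>S. d i = c})"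
      by auto
    then show ?case using insert
      by (subst prod.insert) (auto simp: order_mult lin simp del: mult_pCons_left)
  qed simp
  then show ?thesis
    by (simp add: multiplicity_of_eigenvalue_def char_poly_unitary_diag[OF U])
qed

subsection \<open>A submanifold of matrices with prescribed spectral type\<close>

lemma bounded_bilinear_matrix_mult:
  "bounded_bilinear ((**) :: complex^'n^'n \<Rightarrow> complex^'n^'n \<Rightarrow> complex^'n^'n)"
  by (intro bilinear_conv_bounded_bilinear[THEN iffD1])
    (auto simp: bilinear_def linear_iff vec_eq_iff matrix_matrix_mult_def sum.distrib scaleR_sum_right
      algebra_simps)

lemmas has_derivative_matrix_mult = bounded_bilinear.FDERIV[OF bounded_bilinear_matrix_mult]
lemmas C1_on_matrix_mult = C1_on_bilinear[OF _ _ bounded_bilinear_matrix_mult]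
lemmas tendsto_matrix_mult = bounded_bilinear.tendsto[OF bounded_bilinear_matrix_mult]

text \<open>The map \<open>?f\<close> below is quadratic with derivative the identity at the unit matrix, and \<open>Z\<close> is
  unitary if \<open>?f Z\<close> is skew-Hermitian. So the local inverse of \<open>?f\<close> can replace the exponential map.\<close>

lemma unitary_local_parametrization:
  obtains V and g :: "complex^'n^'n \<Rightarrow> complex^'n^'n"
  where "open V" "0 \<in> V" "C1_on V g" "g 0 = mat 1" "(g has_derivative (\<lambda>x. x)) (at 0)"
    "\<And>K. K \<in> V \<Longrightarrow> conj_transpose K = - K \<Longrightarrow> unitary (g K)"
proof -
  let ?ct = "conj_transpose :: complex^'n^'n \<Rightarrow> complex^'n^'n"
  let ?l = "\<lambda>Z. (1/2) *\<^sub>R (Z - ?ct Z)"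
  \<comment> \<open>The Hermitian part of \<open>?f Z\<close> is half of
    \<open>Z ** conj_transpose Z - mat 1\<close>, the skew-Hermitian part is \<open>?l Z\<close>.
    The sum of \<open>?f Z\<close> and its adjoint is therefore exactly the defect of
    unitarity.\<close>
  let ?f = "\<lambda>Z. (1/2) *\<^sub>R (Z ** ?ct Z) + (?l Z + (-1/2) *\<^sub>R mat 1)"
  have bl: "bounded_linear (\<lambda>Z. (1/2) *\<^sub>R Z :: complex^'n^'n)" "bounded_linear ?l"
    by (intro bounded_linear_const_scaleR bounded_linear_ident bounded_linear_sub
        bounded_linear_conj_transpose)+
  have "C1_on UNIV (\<lambda>Z. Z ** ?ct Z)"
    by (intro C1_on_matrix_mult C1_on_bounded_linear bounded_linear_ident bounded_linear_conj_transpose)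
  then have "C1_on UNIV (\<lambda>Z. (1/2) *\<^sub>R (Z ** ?ct Z))"
    by (rule C1_on_compose[OF _ C1_on_bounded_linear[OF bl(1)]]) (rule subset_UNIV)
  then have C1: "C1_on UNIV ?f"
    by (intro C1_on_add C1_on_bounded_linear[OF bl(2)] C1_on_const)
  have "((\<lambda>Z. Z ** ?ct Z) has_derivative (\<lambda>H. mat 1 ** ?ct H + H ** ?ct (mat 1))) (at (mat 1))"
    by (intro has_derivative_matrix_mult has_derivative_ident
        bounded_linear_imp_has_derivative bounded_linear_conj_transpose)
  then have "((\<lambda>Z. (1/2) *\<^sub>R (Z ** ?ct Z)) has_derivative (\<lambda>H. (1/2) *\<^sub>R (mat 1 ** ?ct H + H ** ?ct (mat 1))))
      (at (mat 1))"
    by (rule has_derivative_scaleR_right)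
  then have "(?f has_derivative (\<lambda>H. (1/2) *\<^sub>R (mat 1 ** ?ct H + H ** ?ct (mat 1)) + (?l H + 0))) (at (mat 1))"
    by (intro has_derivative_add has_derivative_const bounded_linear_imp_has_derivative bl(2))
  moreover have "(1/2) *\<^sub>R (mat 1 ** ?ct H + H ** ?ct (mat 1)) + (?l H + 0) = H" for H
    by (simp add: algebra_simps flip: scaleR_add_left)
  ultimately have der: "(?f has_derivative (\<lambda>H. H)) (at (mat 1))" by simp
  have f1: "?f (mat 1) = 0" by simp
  obtain U' V g where g: "open U'" "mat 1 \<in> U'" "open V" "homeomorphism U' V ?f g"
    "C1_on V g" "(g has_derivative (\<lambda>x. x)) (at (?f (mat 1)))"
    by (rule C1_local_inverse[OF open_UNIV UNIV_I C1 der])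
  have "?f (mat 1) \<in> V"
    using imageI[OF g(2), of ?f] homeomorphism_image1[OF g(4)] by (simp only:)
  then have "0 \<in> V" using f1 by simp
  moreover have "g 0 = mat 1" using homeomorphism_apply1[OF g(4,2)] f1 by simp
  moreover have "(g has_derivative (\<lambda>x. x)) (at 0)" using g(6) f1 by simp
  moreover have "unitary (g K)" if K: "K \<in> V" "?ct K = - K" for K
  proof -
    let ?Z = "g K"
    have fZ: "?f ?Z = K" using homeomorphism_apply2[OF g(4) K(1)] .
    have ctf: "?ct (?f Z) = (1/2) *\<^sub>R (Z ** ?ct Z) + (- ?l Z + (-1/2) *\<^sub>R mat 1)" for Z
      by (simp add: conj_transpose_add conj_transpose_scaleR conj_transpose_diff conj_transpose_mul
          algebra_simps)
    have sum2: "(1/2) *\<^sub>R P + (L + (-1/2) *\<^sub>R M) + ((1/2) *\<^sub>R P + (- L + (-1/2) *\<^sub>R M)) = P - M"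
      for P L M :: "complex^'n^'n" by (simp add: vec_eq_iff complex_eq_iff)
    have "?f ?Z + ?ct (?f ?Z) = 0" unfolding fZ K(2) by simp
    then have "?Z ** ?ct ?Z - mat 1 = 0"
      unfolding ctf sum2 .
    then show ?thesis by (simp add: unitary_def)
  qed
  ultimately show thesis using that g(3,5) by blast
qed

text \<open>For \<open>X\<close> in the tangent space, \<open>skew_part d X\<close> is the skew-Hermitian \<open>K\<close> for which
  \<open>[K, diag_mat d]\<close> is the off-diagonal part of \<open>X\<close>. Entries with \<open>d i = d j\<close> vanish
  by \<open>x / 0 = 0\<close>.\<close>

definition skew_part :: "('n \<Rightarrow> complex) \<Rightarrow> complex^'n^'n \<Rightarrow> complex^'n^'n" where
  "skew_part d X = (\<chi> i j. X $ i $ j / (d j - d i))"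

definition diag_part :: "'a::zero^'n^'n \<Rightarrow> 'a^'n^'n" where
  "diag_part X = diag_mat (\<lambda>i. X $ i $ i)"

text \<open>The space \<open>W(d)\<close> of the overview, given by equations instead of generators,
  so that tangent vectors can be tested for membership.\<close>

definition spectral_tangent :: "('n \<Rightarrow> complex) \<Rightarrow> (complex^'n^'n) set" where
  "spectral_tangent d = {X. conj_transpose (skew_part d X) = - skew_part d X \<and>
     (\<forall>i j. d i = d j \<longrightarrow> (i \<noteq> j \<longrightarrow> X $ i $ j = 0) \<and> X $ i $ i = X $ j $ j)}"

lemma linear_skew_part: "linear (skew_part d)"
  by (auto simp: linear_iff skew_part_def vec_eq_iff divide_inverse algebra_simps)

lemma linear_diag_part: "linear (diag_part :: complex^'n^'n \<Rightarrow> complex^'n^'n)"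
  by (auto simp: linear_iff diag_part_def vec_eq_iff diag_mat_nth)

lemma spectral_tangentD:
  assumes "X \<in> spectral_tangent d"
  shows "conj_transpose (skew_part d X) = - skew_part d X"
    and "\<And>i j. d i = d j \<Longrightarrow> i \<noteq> j \<Longrightarrow> X $ i $ j = 0"
    and "\<And>i j. d i = d j \<Longrightarrow> X $ i $ i = X $ j $ j"
proof -
  note h = assms[unfolded spectral_tangent_def mem_Collect_eq]
  note h2 = conjunct2[OF h, rule_format]
  show "conj_transpose (skew_part d X) = - skew_part d X" by (rule conjunct1[OF h])
  show "X $ i $ j = 0" if "d i = d j" "i \<noteq> j" for i j
    by (rule mp[OF conjunct1[OF h2[OF that(1)]] that(2)])
  show "X $ i $ i = X $ j $ j" if "d i = d j" for i j
    by (rule conjunct2[OF h2[OF that]])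
qed

lemma subspace_spectral_tangent: "subspace (spectral_tangent d)"
proof (rule subspaceI)
  note lin = linear_0[OF linear_skew_part] linear_add[OF linear_skew_part]
    linear_scale[OF linear_skew_part] conj_transpose_add conj_transpose_scaleR
  show "0 \<in> spectral_tangent d"
    by (simp add: spectral_tangent_def lin) (simp add: conj_transpose_def vec_eq_iff)
  note D = spectral_tangentD
  fix X Y assume X: "X \<in> spectral_tangent d"
  show "c *\<^sub>R X \<in> spectral_tangent d" for c
    unfolding spectral_tangent_def mem_Collect_eq lin vector_scaleR_component
    by (intro conjI allI impI arg_cong[of _ _ "(*\<^sub>R) c"] D(3)[OF X])
      (simp_all add: D(1,2)[OF X])
  assume Y: "Y \<in> spectral_tangent d"
  show "X + Y \<in> spectral_tangent d"
    unfolding spectral_tangent_def mem_Collect_eq lin vector_add_component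
    by (intro conjI allI impI arg_cong2[of _ _ _ _ "(+)"] D(3)[OF X] D(3)[OF Y])
      (simp_all add: D(1,2)[OF X] D(1,2)[OF Y])
qed

text \<open>\<open>F\<close> conjugates the shifted diagonal matrix by a unitary matrix obtained
  from \<open>skew_part d X\<close>. Its derivative at 0 sends \<open>X\<close> to the commutator of
  \<open>skew_part d X\<close> with \<open>diag_mat d\<close>, plus \<open>diag_part X\<close>; by
  the choice of \<open>skew_part\<close> this is \<open>X\<close> itself on
  \<open>spectral_tangent d\<close>.\<close>

lemma spectral_submanifold:
  fixes d :: "'n::finite \<Rightarrow> complex"
  shows "\<exists>M. M \<noteq> {} \<and> submanifold (dim (spectral_tangent d)) M \<and>
    M \<subseteq> {U ** diag_mat e ** conj_transpose U | U e. unitary U \<and> (\<forall>i j. e i = e j \<longleftrightarrow> d i = d j)}"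
    (is "\<exists>M. _ \<and> _ \<and> M \<subseteq> ?S")
proof -
  obtain V and g :: "complex^'n^'n \<Rightarrow> complex^'n^'n" where g: "open V" "0 \<in> V" "C1_on V g" "g 0 = mat 1"
    "(g has_derivative (\<lambda>x. x)) (at 0)"
    and unit: "\<And>K. K \<in> V \<Longrightarrow> conj_transpose K = - K \<Longrightarrow> unitary (g K)"
    by (rule unitary_local_parametrization) (rule that)
  let ?K = "skew_part d"
  let ?E = "\<lambda>X. diag_part X + diag_mat d"
  \<comment> \<open>The second condition keeps distinct eigenvalues distinct. Equal ones stay equal
    without a condition here, since a matrix in \<open>spectral_tangent d\<close> has constant
    diagonal on each block.\<close>
  define Om where "Om = ?K -` V \<inter> {X. \<forall>i j. d i \<noteq> d j \<longrightarrow> X $ i $ i + d i \<noteq> X $ j $ j + d j}"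
  define F where "F = (\<lambda>X. g (?K X) ** ?E X ** conj_transpose (g (?K X)))"
  \<comment> \<open>The factors \<open>mat 1\<close> are the values of \<open>g (?K X)\<close> at 0,
    left in so that the product rule matches literally.\<close>
  define F' where "F' = (\<lambda>X. (mat 1 ** diag_mat d) ** conj_transpose (?K X)
      + (mat 1 ** diag_part X + ?K X ** diag_mat d) ** conj_transpose (mat 1))"
  have blK: "bounded_linear ?K" and blD: "bounded_linear (diag_part :: complex^'n^'n \<Rightarrow> _)"
    using linear_skew_part linear_diag_part by (simp_all add: linear_conv_bounded_linear)
  note K0 = linear_0[OF linear_skew_part, of d] and D0 = linear_0[OF linear_diag_part]
  have "open (?K -` V)" by (intro open_vimage g(1) linear_continuous_on blK)
  moreover have "open {X :: complex^'n^'n. \<forall>i j. d i \<noteq> d j \<longrightarrow> X $ i $ i + d i \<noteq> X $ j $ j + d j}"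
    unfolding Collect_all_eq
    by (intro open_INT finite ballI open_Collect_imp open_Collect_neq closed_Collect_const continuous_intros)
  ultimately have "open Om" unfolding Om_def by blast
  moreover have "0 \<in> Om" using g(2) by (simp add: Om_def K0)
  moreover have "C1_on Om F"
  proof -
    have gK: "C1_on Om (\<lambda>X. g (?K X))"
      by (rule C1_on_compose[OF C1_on_bounded_linear[OF blK] g(3)]) (auto simp: Om_def)
    then have "C1_on Om (\<lambda>X. conj_transpose (g (?K X)))"
      by (rule C1_on_compose[OF _ C1_on_bounded_linear[OF bounded_linear_conj_transpose]])
        (rule subset_UNIV)
    with gK show ?thesis
      unfolding F_def by (intro C1_on_matrix_mult C1_on_add C1_on_const C1_on_bounded_linear[OF blD])
  qed
  moreover have "(F has_derivative F') (at 0)"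
  proof -
    have gK: "((\<lambda>X. g (?K X)) has_derivative (\<lambda>X. ?K X)) (at 0)"
      using g(5) by (intro has_derivative_compose[OF bounded_linear_imp_has_derivative[OF blK]])
        (simp add: K0)
    then have ct: "((\<lambda>X. conj_transpose (g (?K X))) has_derivative (\<lambda>X. conj_transpose (?K X))) (at 0)"
      by (rule bounded_linear.has_derivative[OF bounded_linear_conj_transpose])
    have "(?E has_derivative (\<lambda>X. diag_part X + 0)) (at 0)"
      by (intro has_derivative_add has_derivative_const bounded_linear_imp_has_derivative blD)
    from has_derivative_matrix_mult[OF has_derivative_matrix_mult[OF gK this] ct]
    show ?thesis by (simp add: F_def F'_def K0 D0 g(4))
  qed
  moreover have "F' X = X" if X: "X \<in> spectral_tangent d" for X
  proof -
    have "F' X $ i $ j = X $ i $ j" for i j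
    proof -
      have "F' X $ i $ j = ?K X $ i $ j * (d j - d i) + (if i = j then X $ i $ i else 0)"
        by (simp add: F'_def spectral_tangentD(1)[OF X] diag_mat_mult_nth mult_diag_mat_nth
            matrix_mult_diff_right diag_part_def diag_mat_nth algebra_simps)
      also have "\<dots> = X $ i $ j"
        using spectral_tangentD(2)[OF X, of i j] by (simp add: skew_part_def)
      finally show ?thesis .
    qed
    then show ?thesis by (simp add: vec_eq_iff)
  qed
  moreover have "F X \<in> ?S" if X: "X \<in> spectral_tangent d \<inter> Om" for X
  proof -
    let ?e = "\<lambda>i. X $ i $ i + d i"
    have "unitary (g (?K X))"
      using X by (intro unit spectral_tangentD(1)) (auto simp: Om_def)
    moreover have "?E X = diag_mat ?e" by (simp add: diag_part_def diag_mat_def vec_eq_iff)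
    moreover have "?e i = ?e j \<longleftrightarrow> d i = d j" for i j
      using X spectral_tangentD(3)[of X d i j] by (auto simp: Om_def)
    ultimately show ?thesis by (auto simp: F_def)
  qed
  ultimately have "\<exists>M. M \<noteq> {} \<and> M \<subseteq> ?S \<and> submanifold (dim (spectral_tangent d)) M"
    by (intro submanifold_immersion[OF subspace_spectral_tangent, where Om = Om and F = F and F' = F'])
  then show ?thesis by (elim exE conjE) (intro exI conjI)
qed

subsection \<open>Tangent vectors to families of normal matrices\<close>

lemma poly_apply_diag_mat: "poly_apply (diag_mat d) v p $ i = poly p (d i) * v $ i"
  by (induction p) (simp_all add: diag_mat_mult_vec algebra_simps)

lemma poly_apply_unitary_conj:
  assumes U: "unitary U"
  shows "poly_apply (U ** B ** conj_transpose U) v p = U *v poly_apply B (conj_transpose U *v v) p"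
proof (induction p)
  case (pCons a p)
  have "U *v (conj_transpose U *v v) = v"
    using unitaryD(1)[OF U] by (simp add: matrix_vector_mul_assoc)
  moreover have "(U ** B ** conj_transpose U) *v (U *v w) = U *v (B *v w)" for w
    using unitaryD(2)[OF U] by (metis matrix_mul_assoc matrix_mul_rid matrix_vector_mul_assoc)
  ultimately show ?case
    using pCons by (simp add: matrix_vector_right_distrib vector_scalar_commute)
qed simp

text \<open>Diagonalizability makes simple roots suffice: a product over the distinct eigenvalues
  annihilates \<open>B\<close> whatever their multiplicities.\<close>

lemma poly_apply_normal_eq_0:
  assumes "normal_matrix B" "\<And>c. c \<in> eigenvalues B \<Longrightarrow> poly p c = 0"
  shows "poly_apply B v p = 0"
proof -
  obtain U d where U: "unitary U" and B: "B = U ** diag_mat d ** conj_transpose U"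
    by (rule normal_unitarily_diagonalizable[OF assms(1)])
  have "poly p (d i) = 0" for i
    using assms(2) unfolding B eigenvalues_unitary_diag[OF U] by blast
  then have "poly_apply (diag_mat d) w p = 0" for w
    by (simp add: vec_eq_iff poly_apply_diag_mat)
  then show ?thesis by (simp add: B poly_apply_unitary_conj[OF U])
qed

section \<open>Limits of matrices and of their eigenvalues\<close>

lemma bounded_bilinear_matrix_vector_mult:
  "bounded_bilinear ((*v) :: complex^'n^'n \<Rightarrow> complex^'n \<Rightarrow> complex^'n)"
  by (intro bilinear_conv_bounded_bilinear[THEN iffD1])
    (auto simp: bilinear_def linear_iff vec_eq_iff matrix_vector_mult_def sum.distrib scaleR_sum_right
      algebra_simps)

lemma bounded_bilinear_vector_scalar_mult:
  "bounded_bilinear ((*s) :: complex \<Rightarrow> complex^'n \<Rightarrow> complex^'n)"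
  by (intro bilinear_conv_bounded_bilinear[THEN iffD1])
    (auto simp: bilinear_def linear_iff vec_eq_iff algebra_simps)

lemmas tendsto_matrix_vector_mult = bounded_bilinear.tendsto[OF bounded_bilinear_matrix_vector_mult]
lemmas tendsto_vector_scalar_mult = bounded_bilinear.tendsto[OF bounded_bilinear_vector_scalar_mult]

lemma tendsto_poly_apply_prod:
  assumes "(B \<longlongrightarrow> A) F" "finite J" "\<And>j. j \<in> J \<Longrightarrow> ((\<lambda>m. \<mu> m j) \<longlongrightarrow> l j) F"
  shows "((\<lambda>m. poly_apply (B m) v (\<Prod>j\<in>J. [:- \<mu> m j, 1:])) \<longlongrightarrow> poly_apply A v (\<Prod>j\<in>J. [:- l j, 1:])) F"
  using assms(2,3)
proof (induction J rule: finite_induct)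
  case (insert j J)
  have prod: "(\<Prod>j\<in>insert j J. [:- f j, 1:]) = [:- f j, 1:] * (\<Prod>j\<in>J. [:- f j, 1:])"
    for f :: "_ \<Rightarrow> complex" by (rule prod.insert[OF insert(1,2)])
  show ?case
    unfolding prod poly_apply_linear_factor
    by (intro tendsto_diff tendsto_matrix_vector_mult tendsto_vector_scalar_mult assms(1) insert) auto
qed (simp add: one_pCons)

text \<open>Eigenvalues of a convergent sequence of matrices therefore stay bounded, which starts
  the compactness argument.\<close>

lemma eigenvalue_norm_bound:
  obtains K where "\<And>(B :: complex^'n^'n) c. c \<in> eigenvalues B \<Longrightarrow> norm c \<le> norm B * K"
proof -
  obtain K where K: "\<And>(B :: complex^'n^'n) v. norm (B *v v) \<le> norm B * norm v * K"
    using bounded_bilinear.bounded[OF bounded_bilinear_matrix_vector_mult] by blast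
  have nc: "norm (c *s v) = norm c * norm v" for c :: complex and v :: "complex^'n"
    by (simp add: norm_vec_def norm_mult L2_set_right_distrib)
  have "norm c \<le> norm B * K" if "c \<in> eigenvalues B" for B :: "complex^'n^'n" and c
  proof -
    from that obtain v where v: "v \<noteq> 0" "B *v v = c *s v" by (auto simp: eigenvalues_def)
    have "norm c * norm v \<le> norm B * K * norm v"
      using K[of B v] by (simp add: v(2) nc mult_ac)
    then show ?thesis using v(1) by simp
  qed
  then show thesis by (rule that)
qed

lemma bounded_family_convergent_subsequence:
  fixes \<mu> :: "nat \<Rightarrow> 'j \<Rightarrow> 'b::heine_borel"
  assumes "finite J" "\<And>j. j \<in> J \<Longrightarrow> bounded (range (\<lambda>m. \<mu> m j))"
  obtains r l where "strict_mono r" "\<And>j. j \<in> J \<Longrightarrow> (\<lambda>m. \<mu> (r m) j) \<longlonglongrightarrow> l j"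
proof -
  have "\<exists>r l. strict_mono r \<and> (\<forall>j\<in>J. (\<lambda>m. \<mu> (r m) j) \<longlonglongrightarrow> l j)"
    using assms
  proof (induction J rule: finite_induct)
    case empty
    show ?case by (intro exI[of _ id]) (simp add: strict_mono_def)
  next
    case (insert k J)
    then obtain r l where r: "strict_mono r" "\<And>j. j \<in> J \<Longrightarrow> (\<lambda>m. \<mu> (r m) j) \<longlonglongrightarrow> l j"
      by blast
    have "bounded (range (\<lambda>m. \<mu> (r m) k))"
      by (rule bounded_subset[OF insert.prems[of k]]) auto
    then obtain a s where s: "strict_mono s" "((\<lambda>m. \<mu> (r m) k) \<circ> s) \<longlonglongrightarrow> a"
      using bounded_imp_convergent_subsequence by blast
    have "(\<lambda>m. \<mu> (r (s m)) j) \<longlonglongrightarrow> l j" if "j \<in> J" for j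
      using LIMSEQ_subseq_LIMSEQ[OF r(2)[OF that] s(1)] by (simp add: o_def)
    then show ?case
      using insert(2) s strict_mono_o[OF r(1) s(1)]
      by (intro exI[of _ "r \<circ> s"] exI[of _ "l(k := a)"]) (auto simp: o_def)
  qed
  then show thesis using that by blast
qed

lemma eigenvalues_normal_finite_nonempty:
  assumes "normal_matrix (B :: complex^'n^'n)"
  shows "finite (eigenvalues B)" "eigenvalues B \<noteq> {}"
proof -
  obtain U d where U: "unitary U" and B: "B = U ** diag_mat d ** conj_transpose U"
    by (rule normal_unitarily_diagonalizable[OF assms])
  show "finite (eigenvalues B)" "eigenvalues B \<noteq> {}"
    unfolding B eigenvalues_unitary_diag[OF U] by simp_all
qed

text \<open>Repetitions are allowed, so that one fixed index set serves a whole sequence of matrices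
  even if some have fewer eigenvalues; surplus indices all receive the same eigenvalue
  \<open>c\<close>.\<close>

lemma eigenvalue_enumeration:
  assumes B: "normal_matrix (B :: complex^'n^'n)" and J: "finite J" "card (eigenvalues B) \<le> card J"
  shows "\<exists>\<mu>. \<mu> ` J = eigenvalues B"
proof -
  note E = eigenvalues_normal_finite_nonempty[OF B]
  obtain f where f: "f ` eigenvalues B \<subseteq> J" "inj_on f (eigenvalues B)"
    using card_le_inj[OF E(1) J] by blast
  obtain c where c: "c \<in> eigenvalues B" using E(2) by blast
  let ?m = "\<lambda>j. if j \<in> f ` eigenvalues B then inv_into (eigenvalues B) f j else c"
  have "?m ` J \<subseteq> eigenvalues B" using c by (auto simp: inv_into_into)
  moreover have "eigenvalues B \<subseteq> ?m ` J"
  proof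
    fix x assume "x \<in> eigenvalues B"
    then have "?m (f x) = x" "f x \<in> J" using f by auto
    then show "x \<in> ?m ` J" by (intro image_eqI[of _ _ "f x"]) simp_all
  qed
  ultimately show ?thesis by blast
qed

text \<open>A block of equal diagonal entries \<open>d i = c\<close> perturbs as a multiple of the identity to first order:
  if \<open>\<mu>\<close> is the nearby eigenvalue and \<open>w = \<Prod>(B - \<mu>')(e\<^sub>a)\<close> over the other eigenvalues \<open>\<mu>'\<close>, then
  \<open>B w = \<mu> w\<close>, while \<open>w\<close> tends to a nonzero multiple of \<open>e\<^sub>a\<close>.\<close>

lemma block_derivative_scalar:
  fixes B :: "nat \<Rightarrow> complex^'n^'n" and t :: "nat \<Rightarrow> real"
  assumes B: "\<And>m. normal_matrix (B m)" "\<And>m. eigenvalues (B m) = \<mu> m ` range d"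
    and lim: "B \<longlonglongrightarrow> diag_mat d" "(\<lambda>m. (1 / t m) *\<^sub>R (B m - diag_mat d)) \<longlonglongrightarrow> X"
    and \<mu>: "\<And>j. j \<in> range d \<Longrightarrow> (\<lambda>m. \<mu> m j) \<longlonglongrightarrow> l j"
    and ab: "d a = d b"
  shows "a \<noteq> b \<longrightarrow> X $ a $ b = 0" "X $ a $ a = X $ b $ b"
proof -
  let ?J = "range d" and ?D = "diag_mat d"
  have full0: "poly_apply (B m) v (\<Prod>j\<in>?J. [:- \<mu> m j, 1:]) = 0" for m v
    by (rule poly_apply_normal_eq_0[OF B(1)]) (auto simp: B(2) poly_prod)
  have "poly_apply ?D v (\<Prod>j\<in>?J. [:- l j, 1:]) = 0" for v
  proof -
    have "(\<lambda>m. poly_apply (B m) v (\<Prod>j\<in>?J. [:- \<mu> m j, 1:])) \<longlonglongrightarrow> poly_apply ?D v (\<Prod>j\<in>?J. [:- l j, 1:])"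
      by (rule tendsto_poly_apply_prod[OF lim(1)]) (auto intro: \<mu>)
    then show ?thesis unfolding full0 by (simp add: LIMSEQ_const_iff)
  qed
  then have "poly (\<Prod>j\<in>?J. [:- l j, 1:]) (d i) = 0" for i
    using poly_apply_diag_mat[of d "axis i 1" _ i] by (metis axis_nth mult.right_neutral zero_index)
  \<comment> \<open>Every \<open>d i\<close> is a root of the limit polynomial, so the limits
    \<open>l\<close> cover \<open>range d\<close>. As they are indexed by \<open>range d\<close>
    itself, counting forces \<open>l\<close> to be injective: different indices have different
    limits.\<close>
  then have surj: "?J \<subseteq> l ` ?J" by (auto simp: poly_prod image_iff)
  then have inj: "inj_on l ?J"
    by (metis finite finite_imageI card_mono card_image_le eq_card_imp_inj_on le_antisym)
  \<comment> \<open>\<open>j0\<close> indexes the eigenvalue that tends to \<open>d a\<close>. It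
    need not be \<open>d a\<close>, because the enumeration \<open>\<mu>\<close> is arbitrary.
    Injectivity of \<open>l\<close> makes the remaining product \<open>Q l\<close> nonzero at
    \<open>d a\<close>.\<close>
  obtain j0 where j0: "j0 \<in> ?J" "l j0 = d a" using surj by (metis imageE rangeI subsetD)
  define Q where "Q = (\<lambda>\<mu>. \<Prod>j\<in>?J - {j0}. [:- \<mu> j, 1 :: complex:])"
  define w where "w = (\<lambda>i m. poly_apply (B m) (axis i 1) (Q (\<mu> m)))"
  define c where "c = poly (Q l) (d a)"
  have "c \<noteq> 0"
    using inj j0 by (auto simp: c_def Q_def poly_prod inj_on_def)
  have w: "w i \<longlonglongrightarrow> c *s axis i 1" if "d i = d a" for i
  proof -
    have "w i \<longlonglongrightarrow> poly_apply ?D (axis i 1) (Q l)"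
      unfolding w_def Q_def by (rule tendsto_poly_apply_prod[OF lim(1)]) (auto intro: \<mu>)
    also have "poly_apply ?D (axis i 1) (Q l) = c *s axis i 1"
      using that by (auto simp: vec_eq_iff poly_apply_diag_mat c_def axis_def)
    finally show ?thesis .
  qed
  have Bw: "B m *v w i m = \<mu> m j0 *s w i m" for i m
    using full0[of m "axis i 1"] prod.remove[OF _ j0(1), of "\<lambda>j. [:- \<mu> m j, 1:]"]
    by (simp add: w_def Q_def poly_apply_linear_factor del: mult_pCons_left)
  define Y where "Y = (\<lambda>m. (1 / t m) *\<^sub>R (B m - ?D))"
  define s where "s = (\<lambda>m. (1 / t m) *\<^sub>R (\<mu> m j0 - d a))"
  \<comment> \<open>In the coordinates of the block \<open>diag_mat d\<close> multiplies by
    \<open>d a\<close>, and \<open>w i m\<close> is an eigenvector of \<open>B m\<close> or zero;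
    the difference quotient thus acts there as the scalar \<open>s m\<close>.\<close>
  have Yw: "(Y m *v w i m) $ k = s m * (w i m) $ k" if "d k = d a" for i k m
  proof -
    have "Y m *v w i m = (1 / t m) *\<^sub>R ((B m - ?D) *v w i m)"
      unfolding Y_def by (rule bounded_bilinear.scaleR_left[OF bounded_bilinear_matrix_vector_mult])
    then have "(Y m *v w i m) $ k = (1 / t m) *\<^sub>R (\<mu> m j0 * w i m $ k - d k * w i m $ k)"
      by (simp only: matrix_vector_mult_diff_rdistrib Bw vector_scaleR_component
          vector_minus_component vector_smult_component diag_mat_mult_vec)
    then show ?thesis
      using that by (simp add: s_def left_diff_distrib)
  qed
  have limYw: "(\<lambda>m. s m * (w i m) $ k) \<longlonglongrightarrow> c * X $ k $ i" if "d i = d a" "d k = d a" for i k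
  proof -
    have "(\<lambda>m. (Y m *v w i m) $ k) \<longlonglongrightarrow> (X *v (c *s axis i 1)) $ k"
      using lim(2) w[OF that(1)] unfolding Y_def
      by (intro tendsto_vec_nth tendsto_matrix_vector_mult)
    also have "(X *v (c *s axis i 1)) $ k = c * X $ k $ i"
      by (simp add: vector_scalar_commute matrix_vector_mul_component axis_def
          matrix_vector_mult_def if_distrib[of "\<lambda>x. _ * x"] cong: if_cong)
    finally show ?thesis unfolding Yw[OF that(2)] .
  qed
  \<comment> \<open>Convergence of \<open>s\<close> is not given; it follows on dividing by the
    \<open>i\<close>-th coordinate of \<open>w i m\<close>, which tends to the nonzero
    \<open>c\<close>. Every index of the block yields the same sequence \<open>s\<close>, hence
    equal diagonal entries.\<close>
  have s: "s \<longlonglongrightarrow> X $ i $ i" if "d i = d a" for i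
  proof -
    have wi: "(\<lambda>m. (w i m) $ i) \<longlonglongrightarrow> c"
      using tendsto_vec_nth[OF w[OF that], of i] by (simp add: axis_def)
    then have "(\<lambda>m. s m * (w i m) $ i / (w i m) $ i) \<longlonglongrightarrow> c * X $ i $ i / c"
      by (intro tendsto_divide limYw that \<open>c \<noteq> 0\<close>)
    moreover have "\<forall>\<^sub>F m in sequentially. (w i m) $ i \<noteq> 0"
      using wi \<open>c \<noteq> 0\<close> by (rule tendsto_imp_eventually_ne)
    then have "\<forall>\<^sub>F m in sequentially. s m * (w i m) $ i / (w i m) $ i = s m"
      by eventually_elim simp
    ultimately show ?thesis using \<open>c \<noteq> 0\<close> by (simp add: tendsto_cong)
  qed
  show "X $ a $ a = X $ b $ b"
    using LIMSEQ_unique[OF s[OF refl] s[OF ab[symmetric]]] .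
  \<comment> \<open>The \<open>a\<close>-th coordinate of \<open>w b m\<close> tends to 0 while
    \<open>s\<close> converges, so the product tends to 0; its limit is also
    \<open>c * X $ a $ b\<close>.\<close>
  show "a \<noteq> b \<longrightarrow> X $ a $ b = 0"
  proof
    assume "a \<noteq> b"
    then have "(\<lambda>m. (w b m) $ a) \<longlonglongrightarrow> 0"
      using tendsto_vec_nth[OF w[OF ab[symmetric]], of a] by (simp add: axis_def)
    from tendsto_mult[OF s[OF refl] this] have "(\<lambda>m. s m * (w b m) $ a) \<longlonglongrightarrow> 0" by simp
    from LIMSEQ_unique[OF this limYw[OF ab[symmetric] refl]] show "X $ a $ b = 0"
      using \<open>c \<noteq> 0\<close> by simp
  qed
qed

text \<open>The conditions inside blocks come from a subsequence along which all eigenvalues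
  converge; that is harmless because \<open>X\<close> is the limit along every subsequence. The
  condition across blocks comes from the normality equation.\<close>

lemma sequence_tangent_diag:
  fixes B :: "nat \<Rightarrow> complex^'n^'n" and t :: "nat \<Rightarrow> real"
  assumes B: "\<And>m. normal_matrix (B m)" "\<And>m. card (eigenvalues (B m)) \<le> card (range d)"
    and t: "\<And>m. t m \<noteq> 0" "t \<longlonglongrightarrow> 0"
    and lim: "(\<lambda>m. (1 / t m) *\<^sub>R (B m - diag_mat d)) \<longlonglongrightarrow> X"
  shows "X \<in> spectral_tangent d"
proof -
  let ?D = "diag_mat d" and ?ct = "conj_transpose"
  define Y where "Y = (\<lambda>m. (1 / t m) *\<^sub>R (B m - ?D))"
  have Y: "Y \<longlonglongrightarrow> X" using lim by (simp add: Y_def)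
  have BY: "B m = ?D + t m *\<^sub>R Y m" for m using t(1)[of m] by (simp add: Y_def)
  have "(\<lambda>m. ?D + t m *\<^sub>R Y m) \<longlonglongrightarrow> ?D + 0 *\<^sub>R X" by (intro tendsto_intros t(2) Y)
  then have limB: "B \<longlonglongrightarrow> ?D" by (simp add: BY[symmetric])

  have "\<exists>\<mu>. \<mu> ` range d = eigenvalues (B m)" for m
    by (rule eigenvalue_enumeration[OF B(1) finite_imageI[OF finite] B(2)])
  then obtain \<mu> where \<mu>: "\<And>m. \<mu> m ` range d = eigenvalues (B m)" by metis
  obtain K where K: "\<And>(B :: complex^'n^'n) c. c \<in> eigenvalues B \<Longrightarrow> norm c \<le> norm B * K"
    by (rule eigenvalue_norm_bound) (rule that)
  obtain R where R: "\<And>m. norm (B m) \<le> R"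
    using Bseq_def convergent_imp_Bseq[OF convergentI[OF limB]] by (metis BseqD)
  have "bounded (range (\<lambda>m. \<mu> m j))" if "j \<in> range d" for j
  proof (rule boundedI)
    fix x assume "x \<in> range (\<lambda>m. \<mu> m j)"
    then obtain m where m: "x = \<mu> m j" by blast
    have "norm x \<le> norm (B m) * K" using K \<mu> m that by blast
    also have "\<dots> \<le> norm (B m) * \<bar>K\<bar>" by (intro mult_left_mono) auto
    also have "\<dots> \<le> R * \<bar>K\<bar>" by (intro mult_right_mono R) auto
    finally show "norm x \<le> R * \<bar>K\<bar>" .
  qed
  then obtain r l where r: "strict_mono r" "\<And>j. j \<in> range d \<Longrightarrow> (\<lambda>m. \<mu> (r m) j) \<longlonglongrightarrow> l j"
    using bounded_family_convergent_subsequence[of "range d" \<mu>] by (metis finite finite_imageI)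
  have sub: "(\<lambda>m. B (r m)) \<longlonglongrightarrow> ?D" "(\<lambda>m. (1 / t (r m)) *\<^sub>R (B (r m) - ?D)) \<longlonglongrightarrow> X"
    using LIMSEQ_subseq_LIMSEQ[OF limB r(1)] LIMSEQ_subseq_LIMSEQ[OF lim r(1)] by (simp_all add: o_def)
  have block: "(i \<noteq> j \<longrightarrow> X $ i $ j = 0) \<and> X $ i $ i = X $ j $ j" if "d i = d j" for i j
    using block_derivative_scalar[OF B(1) \<mu>[symmetric] sub r(2) that] by blast

  \<comment> \<open>The normality defect of \<open>diag_mat d + s Z\<close> equals \<open>s\<close>
    times \<open>G s Z\<close>, its constant term vanishing because diagonal matrices commute with
    their adjoints. Dividing by \<open>t m\<close> before the limit leaves the first-order equation
    \<open>G 0 X = 0\<close>.\<close>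
  define G where "G = (\<lambda>s Z. Z ** ?ct ?D - ?ct Z ** ?D + (?D ** ?ct Z - ?ct ?D ** Z)
      + s *\<^sub>R (Z ** ?ct Z - ?ct Z ** Z))"
  have "G (t m) (Y m) = 0" for m
  proof -
    have comm: "?D ** ?ct ?D = ?ct ?D ** ?D"
      by (auto simp: conj_transpose_diag_mat vec_eq_iff diag_mat_mult_nth diag_mat_nth)
    note bil = bounded_bilinear.add_left[OF bounded_bilinear_matrix_mult]
      bounded_bilinear.add_right[OF bounded_bilinear_matrix_mult]
      bounded_bilinear.scaleR_left[OF bounded_bilinear_matrix_mult]
      bounded_bilinear.scaleR_right[OF bounded_bilinear_matrix_mult]
    have "B m ** ?ct (B m) - ?ct (B m) ** B m = t m *\<^sub>R G (t m) (Y m)"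
      unfolding BY conj_transpose_add conj_transpose_scaleR bil comm G_def
      by (simp add: algebra_simps)
    then show ?thesis using B(1)[of m] t(1)[of m] by (simp add: normal_matrix_def)
  qed
  moreover have "(\<lambda>m. G (t m) (Y m)) \<longlonglongrightarrow> G 0 X"
    unfolding G_def
    by (intro tendsto_intros tendsto_matrix_mult t(2) Y
        bounded_linear.tendsto[OF bounded_linear_conj_transpose])
  ultimately have "G 0 X = 0" by (simp add: LIMSEQ_const_iff)
  then have eq: "X $ i $ j * cnj (d j) - cnj (X $ j $ i) * d j + (d i * cnj (X $ j $ i) - cnj (d i) * X $ i $ j) = 0"
    for i j
    by (simp add: vec_eq_iff G_def conj_transpose_diag_mat mult_diag_mat_nth diag_mat_mult_nth)
      (simp add: conj_transpose_def)
  \<comment> \<open>Regrouped, \<open>eq\<close> says that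
    \<open>X $ i $ j * cnj (d j - d i)\<close> equals
    \<open>cnj (X $ j $ i) * (d j - d i)\<close>.\<close>
  have "conj_transpose (skew_part d X) = - skew_part d X"
  proof -
    have "cnj (X $ j $ i / (d i - d j)) = - (X $ i $ j / (d j - d i))" for i j
    proof (cases "d i = d j")
      case False
      then have "cnj (d i) \<noteq> cnj (d j)" by simp
      with False eq[of i j] show ?thesis by (simp add: field_simps)
    qed simp
    then show ?thesis by (simp add: vec_eq_iff conj_transpose_def skew_part_def)
  qed
  with block show ?thesis unfolding spectral_tangent_def by blast
qed

text \<open>Sampling the curve at the times \<open>\<tau> m\<close> and conjugating by
  \<open>U\<close> reduces to sequences tending to a diagonal matrix. A shift by \<open>N\<close>
  turns the eventual hypotheses into hypotheses on all terms.\<close>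

lemma tangent_unitary_diag:
  fixes \<gamma> :: "real \<Rightarrow> complex^'n^'n"
  assumes U: "unitary U" and \<gamma>0: "\<gamma> 0 = U ** diag_mat d ** conj_transpose U"
    and \<gamma>': "(\<gamma> has_vector_derivative X) (at 0)"
    and ev: "\<forall>\<^sub>F t in at 0. normal_matrix (\<gamma> t) \<and> card (eigenvalues (\<gamma> t)) \<le> card (range d)"
  shows "conj_transpose U ** X ** U \<in> spectral_tangent d"
proof -
  let ?Q = "\<lambda>t. (1 / t) *\<^sub>R (\<gamma> t - \<gamma> 0)"
  have "(\<gamma> has_derivative (\<lambda>t. t *\<^sub>R X)) (at 0)"
    using \<gamma>' by (simp add: has_vector_derivative_def)
  then have "((\<lambda>t. norm (\<gamma> t - \<gamma> 0 - t *\<^sub>R X) / \<bar>t\<bar>) \<longlongrightarrow> 0) (at 0)"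
    by (simp add: has_derivative_iff_norm)
  moreover have "\<forall>\<^sub>F t in at 0. norm (?Q t - X) \<le> norm (\<gamma> t - \<gamma> 0 - t *\<^sub>R X) / \<bar>t\<bar>"
    unfolding eventually_at_filter
  proof (intro always_eventually allI impI)
    fix t :: real assume t: "t \<noteq> 0"
    have "?Q t - X = (1 / t) *\<^sub>R (\<gamma> t - \<gamma> 0 - t *\<^sub>R X)"
      using t by (simp add: algebra_simps)
    then show "norm (?Q t - X) \<le> norm (\<gamma> t - \<gamma> 0 - t *\<^sub>R X) / \<bar>t\<bar>" by simp
  qed
  ultimately have "((\<lambda>t. ?Q t - X) \<longlongrightarrow> 0) (at 0)"
    by (rule Lim_null_comparison[rotated])
  then have Q: "(?Q \<longlongrightarrow> X) (at 0)" by (simp add: LIM_zero_iff)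

  define \<tau> where "\<tau> = (\<lambda>m. inverse (real (Suc m)))"
  have \<tau>0: "\<tau> \<longlonglongrightarrow> 0" unfolding \<tau>_def by (rule LIMSEQ_inverse_real_of_nat)
  have "filterlim \<tau> (at 0) sequentially"
    using \<tau>0 by (auto simp: filterlim_at \<tau>_def)
  from filterlim_compose[OF Q this] eventually_compose_filterlim[OF ev this]
  have Q\<tau>: "(\<lambda>m. ?Q (\<tau> m)) \<longlonglongrightarrow> X"
    and "\<forall>\<^sub>F m in sequentially. normal_matrix (\<gamma> (\<tau> m)) \<and> card (eigenvalues (\<gamma> (\<tau> m))) \<le> card (range d)"
    by auto
  then obtain N where N: "\<And>m. m \<ge> N \<Longrightarrow> normal_matrix (\<gamma> (\<tau> m)) \<and> card (eigenvalues (\<gamma> (\<tau> m))) \<le> card (range d)"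
    unfolding eventually_sequentially by blast

  define C where "C = (\<lambda>Z :: complex^'n^'n. conj_transpose U ** Z ** U)"
  have CC: "bounded_linear C" unfolding C_def
    by (intro bounded_linear_compose[OF
          bounded_bilinear.bounded_linear_left[OF bounded_bilinear_matrix_mult]
          bounded_bilinear.bounded_linear_right[OF bounded_bilinear_matrix_mult]])
  have CU: "C (V ** diag_mat e ** conj_transpose V)
      = (conj_transpose U ** V) ** diag_mat e ** conj_transpose (conj_transpose U ** V)" for V e
    by (simp add: C_def conj_transpose_mul matrix_mul_assoc)
  have unitUV: "unitary (conj_transpose U ** V)" if "unitary V" for V
    using unitaryD(1)[OF that] unitaryD(2)[OF U]
    by (metis conj_transpose_conj_transpose conj_transpose_mul matrix_mul_assoc matrix_mul_rid unitary_def)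
  have C_normal: "normal_matrix (C Z) \<and> card (eigenvalues (C Z)) = card (eigenvalues Z)"
    if Z: "normal_matrix Z" for Z
  proof -
    obtain V e where V: "unitary V" and VZ: "Z = V ** diag_mat e ** conj_transpose V"
      by (rule normal_unitarily_diagonalizable[OF Z])
    show ?thesis
      unfolding VZ CU by (simp add: eigenvalues_unitary_diag V unitUV normal_unitary_diag)
  qed
  have C0: "C (\<gamma> 0) = diag_mat d"
    unfolding \<gamma>0 CU unitaryD(2)[OF U] by simp
  have "C X \<in> spectral_tangent d"
  proof (rule sequence_tangent_diag)
    show "normal_matrix (C (\<gamma> (\<tau> (m + N))))" "card (eigenvalues (C (\<gamma> (\<tau> (m + N))))) \<le> card (range d)" for m
      using N[of "m + N"] C_normal[of "\<gamma> (\<tau> (m + N))"] by auto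
    show "(\<lambda>m. \<tau> (m + N)) \<longlonglongrightarrow> 0" using \<tau>0 by (rule LIMSEQ_ignore_initial_segment)
    show "\<tau> (m + N) \<noteq> 0" for m by (simp add: \<tau>_def)
    have "(\<lambda>m. C (?Q (\<tau> (m + N)))) \<longlonglongrightarrow> C X"
      by (intro bounded_linear.tendsto[OF CC] LIMSEQ_ignore_initial_segment[OF Q\<tau>])
    then show "(\<lambda>m. (1 / \<tau> (m + N)) *\<^sub>R (C (\<gamma> (\<tau> (m + N))) - diag_mat d)) \<longlonglongrightarrow> C X"
      by (simp add: C0 linear_scale linear_diff bounded_linear.linear[OF CC])
  qed
  then show ?thesis by (simp add: C_def)
qed

text \<open>The bound \<open>max\<close> hands every curve in \<open>M\<close> through
  \<open>A\<close> the eigenvalue count needed for its velocity to lie in the conjugated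
  \<open>spectral_tangent d\<close>; conjugation by \<open>U\<close> is injective and keeps the
  dimension.\<close>

lemma normal_submanifold_dim_le:
  fixes M :: "(complex^'n^'n) set"
  assumes M: "submanifold e M" "M \<subseteq> normal_matrices" and A: "A \<in> M"
    and max: "\<And>B. B \<in> M \<Longrightarrow> card (eigenvalues B) \<le> card (eigenvalues A)"
    and U: "unitary U" and AU: "A = U ** diag_mat d ** conj_transpose U"
  shows "e \<le> dim (spectral_tangent d)"
proof -
  obtain T where T: "subspace T" "dim T = e"
    and curve: "\<And>X. X \<in> T \<Longrightarrow> \<exists>\<gamma> :: real \<Rightarrow> complex^'n^'n. \<gamma> 0 = A \<and>
      (\<gamma> has_vector_derivative X) (at 0) \<and> (\<forall>\<^sub>F t in at 0. \<gamma> t \<in> M)"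
    by (rule submanifold_tangent[OF M(1) A]) (rule that)
  let ?C = "\<lambda>Z. conj_transpose U ** Z ** U"
  have "?C X \<in> spectral_tangent d" if X: "X \<in> T" for X
  proof -
    obtain \<gamma> :: "real \<Rightarrow> complex^'n^'n" where g: "\<gamma> 0 = A" "(\<gamma> has_vector_derivative X) (at 0)"
      "\<forall>\<^sub>F t in at 0. \<gamma> t \<in> M" using curve[OF X] by blast
    have "\<forall>\<^sub>F t in at 0. normal_matrix (\<gamma> t) \<and> card (eigenvalues (\<gamma> t)) \<le> card (range d)"
      using g(3)
    proof eventually_elim
      case (elim t)
      then show ?case using M(2) max unfolding normal_matrices_def AU eigenvalues_unitary_diag[OF U] by blast
    qed
    with g show ?thesis using tangent_unitary_diag[OF U] AU by blast
  qed
  then have sub: "?C ` T \<subseteq> spectral_tangent d" by blast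
  have lin: "linear ?C"
    by (intro linearI)
      (simp_all add: bounded_bilinear.add_left[OF bounded_bilinear_matrix_mult]
        bounded_bilinear.add_right[OF bounded_bilinear_matrix_mult]
        bounded_bilinear.scaleR_left[OF bounded_bilinear_matrix_mult]
        bounded_bilinear.scaleR_right[OF bounded_bilinear_matrix_mult])
  have "U ** ?C Z ** conj_transpose U = Z" for Z
  proof -
    have "U ** ?C Z ** conj_transpose U = (U ** conj_transpose U) ** Z ** (U ** conj_transpose U)"
      by (simp only: matrix_mul_assoc)
    then show ?thesis by (simp add: unitaryD(1)[OF U])
  qed
  then have "inj ?C" by (rule inj_on_inverseI[where g = "\<lambda>Z. U ** Z ** conj_transpose U"])
  then have "dim (?C ` T) = e"
    using dim_image_eq[OF lin inj_on_subset[OF _ subset_UNIV]] T(2) by simp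
  then show ?thesis using dim_subset[OF sub] by simp
qed

subsection \<open>Dimension of the tangent space\<close>

text \<open>A skew-Hermitian \<open>K\<close> is encoded by the real matrix \<open>Re K + Im K\<close>; the scalar on a block is
  stored at a representative index of the block.\<close>

lemma dim_spectral_tangent:
  fixes d :: "'n::finite \<Rightarrow> complex"
  shows "dim (spectral_tangent d) = card {(i, j). d i \<noteq> d j} + 2 * card (range d)"
proof -
  define rep where "rep = (\<lambda>i. inv d (d i))"
  have rep: "d (rep i) = d i" for i by (simp add: rep_def f_inv_into_f)
  have rep_eq: "rep i = rep j" if "d i = d j" for i j using that by (simp add: rep_def)
  define S where "S = inv d ` range d"
  have rep_S: "rep i \<in> S" for i by (auto simp: S_def rep_def)
  have S_rep: "rep i = i" if "i \<in> S" for i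
    using that by (auto simp: S_def rep_def f_inv_into_f)
  have cardS: "card S = card (range d)"
    unfolding S_def by (rule card_image) (rule inj_on_inv_into, simp)
  \<comment> \<open>Coordinates of the code: one real coordinate for each ordered pair across
    blocks, and a real and an imaginary one at each representative diagonal position.
    \<open>Z\<close> is the coordinate subspace they span.\<close>
  define P where "P = {(i, j). d i \<noteq> d j} \<times> {1 :: complex} \<union> (\<lambda>i. (i, i)) ` S \<times> {1, \<i>}"
  define E :: "(complex^'n^'n) set" where "E = (\<lambda>((i, j), c). axis i (axis j c)) ` P"
  define Z where "Z = {Y :: complex^'n^'n. \<forall>b\<in>Basis. b \<notin> E \<longrightarrow> Y \<bullet> b = 0}"
  have "E \<subseteq> Basis"
    by (auto simp: E_def P_def Basis_vec_def Basis_complex_def)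
  then have "dim Z = card E" unfolding Z_def by (rule dim_substandard)
  also have "card E = card P"
    unfolding E_def by (rule card_image) (auto simp: inj_on_def P_def axis_eq_axis axis_eq_0_iff)
  also have "card P = card {(i, j). d i \<noteq> d j} + 2 * card S"
    unfolding P_def
    by (subst card_Un_disjoint) (auto simp: card_cartesian_product card_image inj_on_def)
  finally have dimZ: "dim Z = card {(i, j). d i \<noteq> d j} + 2 * card (range d)" by (simp add: cardS)

  have E_iff: "axis i (axis j c) \<in> E \<longleftrightarrow> ((i, j), c) \<in> P" if "c \<in> {1, \<i>}" for i j c
    using that by (force simp: E_def P_def axis_eq_axis axis_eq_0_iff image_iff)
  have Z: "Y \<in> Z \<longleftrightarrow> (\<forall>i j. (d i \<noteq> d j \<longrightarrow> Im (Y $ i $ j) = 0) \<and>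
      (d i = d j \<longrightarrow> \<not> (i = j \<and> i \<in> S) \<longrightarrow> Y $ i $ j = 0))" for Y
  proof -
    have "Y \<in> Z \<longleftrightarrow> (\<forall>i j. \<forall>c\<in>{1, \<i>}. ((i, j), c) \<notin> P \<longrightarrow> Y $ i $ j \<bullet> c = 0)"
      by (auto simp: Z_def Basis_vec_def Basis_complex_def inner_axis E_iff)
    also have "\<dots> \<longleftrightarrow> (\<forall>i j. (d i \<noteq> d j \<longrightarrow> Im (Y $ i $ j) = 0) \<and>
      (d i = d j \<longrightarrow> \<not> (i = j \<and> i \<in> S) \<longrightarrow> Y $ i $ j = 0))"
    proof (intro all_cong1)
      fix i j
      have "((i, j), 1) \<in> P \<longleftrightarrow> d i \<noteq> d j \<or> i = j \<and> i \<in> S" "((i, j), \<i>) \<in> P \<longleftrightarrow> i = j \<and> i \<in> S"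
        by (auto simp: P_def)
      moreover have "Y $ i $ j = 0 \<longleftrightarrow> Re (Y $ i $ j) = 0 \<and> Im (Y $ i $ j) = 0"
        by (simp add: complex_eq_iff)
      ultimately show "(\<forall>c\<in>{1, \<i>}. ((i, j), c) \<notin> P \<longrightarrow> Y $ i $ j \<bullet> c = 0) \<longleftrightarrow>
        (d i \<noteq> d j \<longrightarrow> Im (Y $ i $ j) = 0) \<and> (d i = d j \<longrightarrow> \<not> (i = j \<and> i \<in> S) \<longrightarrow> Y $ i $ j = 0)"
        by (auto simp: inner_complex_def)
    qed
    finally show ?thesis .
  qed
  define f :: "complex^'n^'n \<Rightarrow> complex^'n^'n" where
    "f = (\<lambda>X. \<chi> i j. if d i = d j then (if i = j \<and> i \<in> S then X $ i $ j else 0)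
      else complex_of_real (Re (skew_part d X $ i $ j) + Im (skew_part d X $ i $ j)))"
  \<comment> \<open>For skew-Hermitian K, the real parts are antisymmetric and the imaginary parts
    symmetric under exchange of \<open>i\<close> and \<open>j\<close>. Half the difference and half
    the sum of the two codes recover them.\<close>
  define g :: "complex^'n^'n \<Rightarrow> complex^'n^'n" where
    "g = (\<lambda>Y. \<chi> i j. if d i = d j then (if i = j then Y $ rep i $ rep i else 0)
      else (d j - d i) * Complex ((Re (Y $ i $ j) - Re (Y $ j $ i)) / 2) ((Re (Y $ i $ j) + Re (Y $ j $ i)) / 2))"
  have "linear f"
    by (auto simp: linear_iff f_def vec_eq_iff linear_add[OF linear_skew_part]
        linear_scale[OF linear_skew_part] complex_eq_iff algebra_simps)
  moreover have "linear g"
    by (auto simp: linear_iff g_def vec_eq_iff complex_eq_iff field_simps)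
  ultimately have lin: "linear f" "linear g" .
  have skew_g: "skew_part d (g Y) $ i $ j = (if d i = d j then 0 else
      Complex ((Re (Y $ i $ j) - Re (Y $ j $ i)) / 2) ((Re (Y $ i $ j) + Re (Y $ j $ i)) / 2))" for Y i j
    by (simp add: skew_part_def g_def)
  have fZ: "f X \<in> Z" for X by (auto simp: Z f_def)
  have gT: "g Y \<in> spectral_tangent d" for Y
    unfolding spectral_tangent_def mem_Collect_eq
  proof (intro conjI allI impI)
    have "cnj (skew_part d (g Y) $ j $ i) = - skew_part d (g Y) $ i $ j" for i j
    proof (cases "d i = d j")
      case False
      note neq = if_not_P[OF False] if_not_P[OF not_sym[OF False]]
      show ?thesis
        unfolding skew_g neq by (rule complex_eqI) (simp_all add: field_simps)
    qed (simp add: skew_g)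
    then show "conj_transpose (skew_part d (g Y)) = - skew_part d (g Y)"
      by (simp add: vec_eq_iff conj_transpose_def)
    fix i j assume ij: "d i = d j"
    show "g Y $ i $ j = 0" if "i \<noteq> j" using that ij by (simp add: g_def)
    show "g Y $ i $ i = g Y $ j $ j" using rep_eq[OF ij] by (simp add: g_def)
  qed
  have fg: "f (g Y) = Y" if Y: "Y \<in> Z" for Y
  proof -
    have "f (g Y) $ i $ j = Y $ i $ j" for i j
    proof (cases "d i = d j")
      case True
      then have "f (g Y) $ i $ j = (if i = j \<and> i \<in> S then Y $ rep i $ rep i else 0)"
        by (auto simp: f_def g_def)
      with True Y show ?thesis unfolding Z by (metis S_rep)
    next
      case False
      then have "f (g Y) $ i $ j = complex_of_real (Re (Y $ i $ j))"
        by (simp add: f_def skew_g field_simps)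
      moreover have "Im (Y $ i $ j) = 0" using False Y unfolding Z by blast
      ultimately show ?thesis by (simp add: complex_eq_iff)
    qed
    then show ?thesis by (simp add: vec_eq_iff)
  qed
  have gf: "g (f X) = X" if X: "X \<in> spectral_tangent d" for X
  proof -
    have "g (f X) $ i $ j = X $ i $ j" for i j
    proof (cases "d i = d j")
      case True
      then have "g (f X) $ i $ j = (if i = j then X $ rep i $ rep i else 0)"
        by (simp add: f_def g_def rep_S)
      also have "\<dots> = X $ i $ j"
        using spectral_tangentD(2)[OF X True] spectral_tangentD(3)[OF X rep, of i] by auto
      finally show ?thesis .
    next
      case False
      let ?K = "skew_part d X"
      have "cnj (?K $ i $ j) = - ?K $ j $ i"
        using arg_cong[OF spectral_tangentD(1)[OF X], of "\<lambda>M. M $ j $ i"]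
        by (simp add: conj_transpose_def)
      then have "Re (?K $ j $ i) = - Re (?K $ i $ j)" "Im (?K $ j $ i) = Im (?K $ i $ j)"
        by (auto simp: complex_eq_iff)
      moreover have "Re (f X $ i $ j) = Re (?K $ i $ j) + Im (?K $ i $ j)"
        "Re (f X $ j $ i) = Re (?K $ j $ i) + Im (?K $ j $ i)"
        using False not_sym[OF False] by (simp_all add: f_def)
      ultimately have "Complex ((Re (f X $ i $ j) - Re (f X $ j $ i)) / 2) ((Re (f X $ i $ j) + Re (f X $ j $ i)) / 2)
          = ?K $ i $ j"
        by (intro complex_eqI) simp_all
      then have "g (f X) $ i $ j = (d j - d i) * ?K $ i $ j"
        using False by (simp add: g_def)
      also have "\<dots> = X $ i $ j" using False by (simp add: skew_part_def)
      finally show ?thesis .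
    qed
    then show ?thesis by (simp add: vec_eq_iff)
  qed
  have "dim (spectral_tangent d) = dim Z"
  proof (rule antisym)
    have "inj_on f (spectral_tangent d)" using gf by (rule inj_on_inverseI)
    then have "dim (f ` spectral_tangent d) = dim (spectral_tangent d)"
      by (intro dim_image_eq[OF lin(1)]) (simp add: span_eq_iff[THEN iffD2] subspace_spectral_tangent)
    moreover have "f ` spectral_tangent d \<subseteq> Z" using fZ by blast
    ultimately show "dim (spectral_tangent d) \<le> dim Z" by (metis dim_subset)
    have "subspace Z" unfolding Z_def by (rule subspace_substandard)
    have "inj_on g Z" using fg by (rule inj_on_inverseI)
    then have "dim (g ` Z) = dim Z"
      by (intro dim_image_eq[OF lin(2)]) (simp add: span_eq_iff[THEN iffD2] \<open>subspace Z\<close>)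
    moreover have "g ` Z \<subseteq> spectral_tangent d" using gT by blast
    ultimately show "dim Z \<le> dim (spectral_tangent d)" by (metis dim_subset)
  qed
  with dimZ show ?thesis by simp
qed

subsection \<open>Dimensions of the sets of normal matrices\<close>

lemma card_pairs_equal:
  fixes d :: "'n::finite \<Rightarrow> 'c"
  assumes ev: "bij_betw ev {1..I} (range d)" and k: "\<And>i. i \<in> {1..I} \<Longrightarrow> card {j. d j = ev i} = k i"
  shows "card {(i, j). d i = d j} = (\<Sum>i=1..I. (k i)\<^sup>2)"
proof -
  have "{(i, j). d i = d j} = (\<Union>c\<in>range d. {i. d i = c} \<times> {j. d j = c})" by auto
  also have "card \<dots> = (\<Sum>c\<in>range d. card ({i. d i = c} \<times> {j. d j = c}))"
    by (rule card_UN_disjoint) auto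
  also have "\<dots> = (\<Sum>i=1..I. card ({j. d j = ev i} \<times> {j. d j = ev i}))"
    by (rule sum.reindex_bij_betw[OF ev, symmetric])
  also have "\<dots> = (\<Sum>i=1..I. (k i)\<^sup>2)"
    by (intro sum.cong refl) (simp add: card_cartesian_product k power2_eq_square)
  finally show ?thesis .
qed

lemma card_pairs_neq:
  fixes d :: "'n::finite \<Rightarrow> 'c"
  shows "card {(i, j). d i \<noteq> d j} + card {(i, j). d i = d j} = CARD('n)\<^sup>2"
proof -
  have "card {(i, j). d i \<noteq> d j} + card {(i, j). d i = d j}
      = card ({(i, j). d i \<noteq> d j} \<union> {(i, j). d i = d j})"
    by (rule card_Un_disjoint[symmetric]) auto
  also have "{(i, j). d i \<noteq> d j} \<union> {(i, j). d i = d j} = UNIV" by auto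
  finally show ?thesis by (simp only: card_prod power2_eq_square)
qed

text \<open>Both summands are largest for simple spectrum: at most n^2 - n ordered pairs with
  different values, and at most n values.\<close>

lemma dim_spectral_tangent_le:
  fixes d :: "'n::finite \<Rightarrow> complex"
  shows "dim (spectral_tangent d) \<le> CARD('n)\<^sup>2 + CARD('n)"
proof -
  have "CARD('n) = card ((\<lambda>i :: 'n. (i, i)) ` UNIV)" by (simp add: card_image inj_on_def)
  also have "\<dots> \<le> card {(i, j). d i = d j}" by (rule card_mono) auto
  finally have "CARD('n) \<le> card {(i, j). d i = d j}" .
  moreover have "card (range d) \<le> CARD('n)" by (rule card_image_le) simp
  ultimately show ?thesis
    using card_pairs_neq[of d] by (simp add: dim_spectral_tangent)
qed

lemma dim_spectral_tangent_inj:
  fixes d :: "'n::finite \<Rightarrow> complex"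
  assumes "inj d"
  shows "dim (spectral_tangent d) = CARD('n)\<^sup>2 + CARD('n)"
proof -
  have "{(i, j). d i = d j} = (\<lambda>i. (i, i)) ` UNIV" using assms by (auto dest: injD)
  then have "card {(i, j). d i = d j} = CARD('n)" by (simp add: card_image inj_on_def)
  moreover have "card (range d) = CARD('n)" using assms by (rule card_image)
  ultimately show ?thesis
    using card_pairs_neq[of d] by (simp add: dim_spectral_tangent)
qed

text \<open>Any \<open>d\<close> with distinct values attains the dimension. For the upper bound a
  point with most eigenvalues exists because their number never exceeds n.\<close>

lemma real_dim_normal_matrices:
  "real_dim (normal_matrices :: (complex^'n^'n) set) = int (CARD('n)\<^sup>2 + CARD('n))"
proof (rule real_dim_eqI)
  obtain h :: "'n \<Rightarrow> nat" where h: "inj h" using finite_imp_inj_to_nat_seg[of "UNIV :: 'n set"] by auto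
  define d where "d = (\<lambda>i. of_nat (h i) :: complex)"
  have "inj d" using h by (auto simp: d_def inj_on_def)
  obtain M where "M \<noteq> {}" "submanifold (CARD('n)\<^sup>2 + CARD('n)) M" and
    M: "M \<subseteq> {U ** diag_mat e ** conj_transpose U | U e. unitary U \<and> (\<forall>i j. e i = e j \<longleftrightarrow> d i = d j)}"
    using spectral_submanifold[of d] unfolding dim_spectral_tangent_inj[OF \<open>inj d\<close>]
    by (elim exE conjE) (rule that)
  moreover have "M \<subseteq> normal_matrices"
    using M by (rule order_trans) (auto simp: normal_matrices_def normal_unitary_diag)
  ultimately show "\<exists>M. M \<noteq> {} \<and> M \<subseteq> (normal_matrices :: (complex^'n^'n) set) \<and>
      submanifold (CARD('n)\<^sup>2 + CARD('n)) M"
    by (intro exI[of _ M] conjI)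
next
  fix e and M :: "(complex^'n^'n) set"
  assume M: "M \<noteq> {}" "M \<subseteq> normal_matrices" "submanifold e M"
  have "card (eigenvalues B) \<le> CARD('n)" if nB: "normal_matrix B" for B :: "complex^'n^'n"
  proof -
    obtain U d where U: "unitary U" and B: "B = U ** diag_mat d ** conj_transpose U"
      by (rule normal_unitarily_diagonalizable[OF nB])
    show ?thesis unfolding B eigenvalues_unitary_diag[OF U] by (rule card_image_le) simp
  qed
  then have "\<forall>B. B \<in> M \<longrightarrow> card (eigenvalues B) < Suc (CARD('n))"
    using M(2) by (auto simp: normal_matrices_def le_imp_less_Suc)
  moreover obtain A0 where "A0 \<in> M" using M(1) by blast
  ultimately obtain A where A: "A \<in> M" "\<And>B. B \<in> M \<Longrightarrow> card (eigenvalues B) \<le> card (eigenvalues A)"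
    using ex_has_greatest_nat[of "\<lambda>B. B \<in> M" A0 "\<lambda>B. card (eigenvalues B)"] by blast
  have "normal_matrix A" using A(1) M(2) by (auto simp: normal_matrices_def)
  then obtain U d where "unitary U" "A = U ** diag_mat d ** conj_transpose U"
    by (rule normal_unitarily_diagonalizable)
  from normal_submanifold_dim_le[OF M(3,2) A this] dim_spectral_tangent_le[of d]
  show "e \<le> CARD('n)\<^sup>2 + CARD('n)" by simp
qed

section \<open>The stratum of prescribed multiplicities\<close>

lemma normal_matrices_with_mults_unitary_diag:
  assumes "unitary U"
  shows "U ** diag_mat d ** conj_transpose U \<in> normal_matrices_with_mults I k \<longleftrightarrow>
    (\<exists>ev. bij_betw ev {1..I} (range d) \<and> (\<forall>i\<in>{1..I}. card {j. d j = ev i} = k i))"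
  using normal_unitary_diag[OF assms]
  by (simp add: normal_matrices_with_mults_def eigenvalues_unitary_diag[OF assms]
      multiplicity_unitary_diag[OF assms])

text \<open>The disjoint union of blocks of sizes \<open>k i\<close> has as many elements as the
  index type; \<open>b\<close> tells in which block an index lands under a bijection.\<close>

lemma ex_index_map_with_fibre_cards:
  assumes "(\<Sum>i=1..I. k i) = CARD('n::finite)"
  obtains b :: "'n::finite \<Rightarrow> nat" where "range b \<subseteq> {1..I}" "\<And>i. i \<in> {1..I} \<Longrightarrow> card {j. b j = i} = k i"
proof -
  let ?S = "SIGMA i:{1..I}. {..<k i}"
  have "card ?S = CARD('n)" using assms by simp
  then obtain f where f: "bij_betw f (UNIV :: 'n set) ?S"
    by (metis finite finite_SigmaI finite_atLeastAtMost finite_lessThan finite_same_card_bij)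
  have fS: "fst (f j) \<in> {1..I}" "f j \<in> {fst (f j)} \<times> {..<k (fst (f j))}" for j
    using bspec[OF bij_betwE[OF f] UNIV_I[of j]] by (cases "f j", simp)+
  have "card {j. (fst \<circ> f) j = i} = k i" if "i \<in> {1..I}" for i
  proof -
    have "f ` {j. (fst \<circ> f) j = i} = {i} \<times> {..<k i}"
    proof
      show "{i} \<times> {..<k i} \<subseteq> f ` {j. (fst \<circ> f) j = i}"
      proof
        fix x assume "x \<in> {i} \<times> {..<k i}"
        then have "x \<in> range f" "fst x = i" using f that by (auto simp: bij_betw_def)
        then show "x \<in> f ` {j. (fst \<circ> f) j = i}" by auto
      qed
      show "f ` {j. (fst \<circ> f) j = i} \<subseteq> {i} \<times> {..<k i}"
      proof (rule image_subsetI)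
        fix j assume "j \<in> {j. (fst \<circ> f) j = i}"
        then show "f j \<in> {i} \<times> {..<k i}" using fS(2)[of j] by simp
      qed
    qed
    then have "card ({i} \<times> {..<k i}) = card {j. (fst \<circ> f) j = i}"
      using f by (metis bij_betw_def card_image inj_on_subset subset_UNIV)
    then show ?thesis by simp
  qed
  moreover have "range (fst \<circ> f) \<subseteq> {1..I}" using fS(1) by auto
  ultimately show thesis using that by blast
qed

lemma real_dim_normal_matrices_with_mults:
  assumes pos: "\<And>i. i \<in> {1..I} \<Longrightarrow> 0 < k i" and sum: "(\<Sum>i=1..I. k i) = CARD('n::finite)"
  shows "real_dim (normal_matrices_with_mults I k :: (complex^'n^'n) set)
    = int (CARD('n)\<^sup>2 + 2 * I) - (\<Sum>i=1..I. (int (k i))\<^sup>2)"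
proof -
  let ?N = "normal_matrices_with_mults I k :: (complex^'n^'n) set"
  obtain b :: "'n \<Rightarrow> nat" where b: "range b \<subseteq> {1..I}" "\<And>i. i \<in> {1..I} \<Longrightarrow> card {j. b j = i} = k i"
    using ex_index_map_with_fibre_cards[OF sum] by blast
  \<comment> \<open>Positivity of the multiplicities enters here: each of the I values really
    occurs.\<close>
  have surj: "i \<in> range b" if "i \<in> {1..I}" for i
  proof -
    have "{j. b j = i} \<noteq> {}" using b(2)[OF that] pos[OF that] by (metis card.empty less_irrefl)
    then show ?thesis by blast
  qed
  define d where "d = (\<lambda>i. of_nat (b i) :: complex)"
  have range_b: "range b = {1..I}" using surj b(1) by blast

  have dim: "int (dim (spectral_tangent e)) = int (CARD('n)\<^sup>2 + 2 * I) - (\<Sum>i=1..I. (int (k i))\<^sup>2)"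
    if "bij_betw ev {1..I} (range e)" "\<forall>i\<in>{1..I}. card {j. e j = ev i} = k i"
    for e :: "'n \<Rightarrow> complex" and ev
  proof -
    have "card (range e) = I" using bij_betw_same_card[OF that(1)] by simp
    moreover have "card {(i, j). e i = e j} = (\<Sum>i=1..I. (k i)\<^sup>2)"
      using card_pairs_equal[OF that(1)] that(2) by blast
    then have "int (card {(i, j). e i = e j}) = (\<Sum>i=1..I. (int (k i))\<^sup>2)" by simp
    moreover have "int (card {(i, j). e i \<noteq> e j}) + int (card {(i, j). e i = e j}) = int (CARD('n)\<^sup>2)"
      using card_pairs_neq[of e] by (metis of_nat_add)
    ultimately show ?thesis by (simp add: dim_spectral_tangent)
  qed

  \<comment> \<open>Membership in the stratum depends only on the coincidence pattern of the
    diagonal, so the whole submanifold built from \<open>d\<close> lies in it.\<close>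
  have enum: "\<exists>ev. bij_betw ev {1..I} (range e) \<and> (\<forall>i\<in>{1..I}. card {j. e j = ev i} = k i)"
    if e: "\<And>i j. e i = e j \<longleftrightarrow> b i = b j" for e :: "'n \<Rightarrow> complex"
  proof -
    let ?ev = "\<lambda>i. e (inv b i)"
    have bi: "b (inv b i) = i" if "i \<in> {1..I}" for i using surj[OF that] by (rule f_inv_into_f)
    have "inj_on ?ev {1..I}" by (auto simp: inj_on_def e bi)
    moreover have "?ev (b j) = e j" for j by (simp add: e f_inv_into_f)
    then have "?ev ` {1..I} = range e" unfolding range_b[symmetric] image_image by simp
    ultimately have "bij_betw ?ev {1..I} (range e)" by (simp add: bij_betw_def)
    moreover have "\<forall>i\<in>{1..I}. card {j. e j = ?ev i} = k i" by (simp add: e bi b(2))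
    ultimately show ?thesis by blast
  qed

  have dim_d: "int (dim (spectral_tangent d)) = int (CARD('n)\<^sup>2 + 2 * I) - (\<Sum>i=1..I. (int (k i))\<^sup>2)"
    using enum[of d] dim by (auto simp: d_def)
  have "real_dim ?N = int (dim (spectral_tangent d))"
  proof (rule real_dim_eqI)
    obtain M where "M \<noteq> {}" "submanifold (dim (spectral_tangent d)) M" and
      M: "M \<subseteq> {U ** diag_mat e ** conj_transpose U | U e. unitary U \<and> (\<forall>i j. e i = e j \<longleftrightarrow> d i = d j)}"
      using spectral_submanifold[of d] by (elim exE conjE) (rule that)
    moreover have "U ** diag_mat e ** conj_transpose U \<in> ?N"
      if "unitary U" "\<forall>i j. e i = e j \<longleftrightarrow> d i = d j" for U e
      unfolding normal_matrices_with_mults_unitary_diag[OF that(1)]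
      by (rule enum) (simp add: that(2) d_def)
    then have "M \<subseteq> ?N" using M by (intro order_trans[OF M]) auto
    ultimately show "\<exists>M. M \<noteq> {} \<and> M \<subseteq> ?N \<and> submanifold (dim (spectral_tangent d)) M"
      by (intro exI[of _ M] conjI)
  next
    fix e and M :: "(complex^'n^'n) set"
    assume M: "M \<noteq> {}" "M \<subseteq> ?N" "submanifold e M"
    have card_ev: "card (eigenvalues B) = I" if B: "B \<in> M" for B
    proof -
      obtain ev where "bij_betw ev {1..I} (eigenvalues B)"
        using B M(2) unfolding normal_matrices_with_mults_def by blast
      from bij_betw_same_card[OF this] show ?thesis by simp
    qed
    obtain A where A: "A \<in> M" using M(1) by blast
    have normal: "M \<subseteq> normal_matrices"
      using M(2) by (auto simp: normal_matrices_def normal_matrices_with_mults_def)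
    then have "normal_matrix A" using A by (auto simp: normal_matrices_def)
    then obtain U c where U: "unitary U" and AU: "A = U ** diag_mat c ** conj_transpose U"
      by (rule normal_unitarily_diagonalizable)
    \<comment> \<open>All points of \<open>M\<close> have exactly I eigenvalues, so any
      \<open>A\<close> has the maximal number.\<close>
    have "e \<le> dim (spectral_tangent c)"
      by (rule normal_submanifold_dim_le[OF M(3) normal A _ U AU]) (simp add: card_ev A)
    \<comment> \<open>The dimension depends only on the multiplicities, which \<open>c\<close> and
      \<open>d\<close> share up to the naming of eigenvalues.\<close>
    moreover have "dim (spectral_tangent c) = dim (spectral_tangent d)"
    proof -
      obtain ev where "bij_betw ev {1..I} (range c)" "\<forall>i\<in>{1..I}. card {j. c j = ev i} = k i"
        using A M(2) normal_matrices_with_mults_unitary_diag[OF U, of c I k] unfolding AU by blast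
      from dim[OF this] dim_d show ?thesis by simp
    qed
    ultimately show "e \<le> dim (spectral_tangent d)" by simp
  qed
  with dim_d show ?thesis by simp
qed

theorem corollary2p2:
  fixes I :: nat and k :: "nat \<Rightarrow> nat"
  assumes "\<And>i. i \<in> {1..I} \<Longrightarrow> 0 < k i"
    and "(\<Sum>i=1..I. k i) = CARD('n::finite)"
  shows "real_codim_in_normal (normal_matrices_with_mults I k :: (complex^'n^'n) set)
           = int CARD('n) + (\<Sum>i=1..I. (int (k i))\<^sup>2) - 2 * int I
         \<and> int CARD('n) + (\<Sum>i=1..I. (int (k i))\<^sup>2) - 2 * int I
           = (\<Sum>i=1..I. (int (k i) - 1) * (int (k i) + 2))"
proof
  show "real_codim_in_normal (normal_matrices_with_mults I k :: (complex^'n^'n) set)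
      = int CARD('n) + (\<Sum>i=1..I. (int (k i))\<^sup>2) - 2 * int I"
    using real_dim_normal_matrices_with_mults[OF assms]
    by (simp add: real_codim_in_normal_def real_dim_normal_matrices)
  \<comment> \<open>Writing n as the sum of the \<open>k i\<close> reduces the second identity to
    one for each summand.\<close>
  have "int CARD('n) = (\<Sum>i=1..I. int (k i))" using assms(2) by (metis of_nat_sum)
  moreover have "(int (k i) - 1) * (int (k i) + 2) = (int (k i))\<^sup>2 + int (k i) - 2" for i
    by (simp add: power2_eq_square algebra_simps)
  ultimately show "int CARD('n) + (\<Sum>i=1..I. (int (k i))\<^sup>2) - 2 * int I
      = (\<Sum>i=1..I. (int (k i) - 1) * (int (k i) + 2))"
    by (simp add: sum.distrib sum_subtractf)
qed

end
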